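(* For every planar graph $G$, we have $\gamma(G)\le 10\cdot\rho(G)$.
   Context: All graphs are finite and simple. For a vertex $v$ of a graph $G$, $N_G[v]$ denotes the closed neighborhood of $v$. A dominating set of $G$ is a set of vertices whose closed neighborhoods together cover $V(G)$; $\gamma(G)$ denotes the minimum size of a dominating set. A packing in $G$ is a set of vertices whose closed neighborhoods are pairwise disjoint (equivalently, pairwise at distance at least $3$); $\rho(G)$ denotes the maximum size of a packing. *)

theory Defs
  imports "HOL-Analysis.Analysis" "Graph_Theory.Digraph"
begin

text \<open>
  Finite simple graphs are the finite, loop-free, symmetric digraphs without parallel arcs of the
  locale \<^locale>\<open>graph\<close>; an undirected edge is a pair of opposite arcs. In that library
  \<open>dominates\<close> is the name of adjacency; it is not domination in the sense used here.
\<close>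

definition closed_nbhd :: "('a, 'b) pre_digraph \<Rightarrow> 'a \<Rightarrow> 'a set" where
  "closed_nbhd G v = insert v {u \<in> verts G. v \<rightarrow>\<^bsub>G\<^esub> u}"

definition dominating_set :: "('a, 'b) pre_digraph \<Rightarrow> 'a set \<Rightarrow> bool" where
  "dominating_set G D \<longleftrightarrow> D \<subseteq> verts G \<and> (\<Union>v\<in>D. closed_nbhd G v) = verts G"

definition domination_number :: "('a, 'b) pre_digraph \<Rightarrow> nat" where
  "domination_number G = Min (card ` {D. dominating_set G D})"

definition packing :: "('a, 'b) pre_digraph \<Rightarrow> 'a set \<Rightarrow> bool" where
  "packing G S \<longleftrightarrow>
     S \<subseteq> verts G \<and> pairwise (\<lambda>u v. closed_nbhd G u \<inter> closed_nbhd G v = {}) S"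

definition packing_number :: "('a, 'b) pre_digraph \<Rightarrow> nat" where
  "packing_number G = Max (card ` {S. packing G S})"

text \<open>\<^const>\<open>Min\<close> and \<^const>\<open>Max\<close> are unspecified on empty and infinite sets;
  the following four lemmas exclude these cases.\<close>

lemma (in graph) dominating_set_verts: "dominating_set G (verts G)"
  by (auto simp: dominating_set_def closed_nbhd_def)

lemma (in graph) finite_dominating_sets: "finite {D. dominating_set G D}"
  by (rule finite_subset[of _ "Pow (verts G)"]) (auto simp: dominating_set_def)

lemma packing_empty: "packing G {}"
  by (simp add: packing_def)

lemma (in graph) finite_packings: "finite {S. packing G S}"
  by (rule finite_subset[of _ "Pow (verts G)"]) (auto simp: packing_def)

definition edges :: "('a, 'b) pre_digraph \<Rightarrow> 'a set set" where
  "edges G = {{u, v} |u v. u \<rightarrow>\<^bsub>G\<^esub> v}"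

text \<open>
  A drawing without crossings in the plane \<^typ>\<open>complex\<close>: \<open>p\<close> places the vertices at
  distinct points, and \<open>c e\<close> is a simple arc joining the ends of the edge \<open>e\<close>.
\<close>

definition plane_drawing ::
    "('a, 'b) pre_digraph \<Rightarrow> ('a \<Rightarrow> complex) \<Rightarrow> ('a set \<Rightarrow> real \<Rightarrow> complex) \<Rightarrow> bool" where
  "plane_drawing G p c \<longleftrightarrow>
     inj_on p (verts G) \<and>
     (\<forall>e\<in>edges G. arc (c e) \<and> {pathstart (c e), pathfinish (c e)} = p ` e \<and>
        path_image (c e) \<inter> p ` verts G = p ` e) \<and>
     (\<forall>e\<in>edges G. \<forall>f\<in>edges G. e \<noteq> f \<longrightarrow> path_image (c e) \<inter> path_image (c f) \<subseteq> p ` (e \<inter> f))"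

definition planar :: "('a, 'b) pre_digraph \<Rightarrow> bool" where
  "planar G \<longleftrightarrow> (\<exists>p c. plane_drawing G p c)"

end

theory Submission
  imports Defs
begin

text \<open>
  It suffices to find, for every nonempty set \<open>X\<close> of vertices, some \<open>v \<in> X\<close> such that ten vertices
  dominate all of \<open>X\<close> within distance two of \<open>v\<close>: put \<open>v\<close> into the packing, the ten vertices into
  the dominating set, and continue with the vertices of \<open>X\<close> at distance at least three from \<open>v\<close>.
  Let \<open>Y\<close> be the complement of \<open>X\<close>. Delete the edges inside \<open>Y\<close> and replace every \<open>y \<in> Y\<close> with
  at most three neighbours by a clique on these neighbours; this creates no \<open>K5\<close> or \<open>K33\<close> minor.
  If \<open>v\<close> has degree at most nine in the resulting graph, then \<open>v\<close> together with one vertex for each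
  neighbour (the neighbour itself, or a replaced \<open>y\<close> behind a clique edge) does the job. Such a \<open>v\<close>
  exists because a graph without \<open>K5\<close> minor on \<open>n > 0\<close> vertices has at most \<open>3 n - 3\<close> edges
  and the remaining vertices of \<open>Y\<close> have degree at least four.

  That a plane drawing excludes both minors follows from one fact about a Jordan curve: disjoint chords
  with interleaved ends lie on different sides.
\<close>

section \<open>Chords of a Jordan curve\<close>

text \<open>Only the absence of a \<open>K5\<close> minor enters the edge bound. A
  \<open>K33\<close> minor must be excluded as well, because replacing a star by a clique may create
  a \<open>K5\<close> minor where only a \<open>K33\<close> minor was present, namely when the star
  has one leaf in each of three branch sets. Three leaves are the limit of the replacement argument:
  if two leaves share a branch set, at most one leaf is elsewhere and the centre can join that set.
  With four leaves, two in each of two branch sets, this breaks down. Conversely, degree four in the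
  rest of \<open>Y\<close> makes the count work: with degree three, the edge bound on
  \<open>Y\<close> and its neighbours would say nothing about the number of edges between
  \<open>X\<close> and \<open>Y\<close>. The constant ten is 6 + 4: six is the slope of the edge
  bound when every edge counts twice, and four per vertex of \<open>X\<close> pays for
  \<open>Y\<close>. The average degree on \<open>X\<close> is thus below ten, and the tenth
  dominating vertex is \<open>v\<close> itself. Faces are never counted. The bound 3 n - 3 is weaker
  than the one from Euler's formula, but only its slope and the strictness of the final inequality
  matter.\<close>

lemma arc_subset_closure_endless:
  fixes g :: "real \<Rightarrow> 'a::euclidean_space"
  assumes "arc g"
  shows "path_image g \<subseteq> closure (path_image g - {pathstart g, pathfinish g})"
proof
  fix z assume z: "z \<in> path_image g"
  have "connected (path_image g)" and "pathstart g \<noteq> pathfinish g"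
    using connected_path_image[OF arc_imp_path[OF assms]] arc_distinct_ends[OF assms] by simp_all
  moreover have "pathstart g \<in> path_image g" "pathfinish g \<in> path_image g"
    by auto
  \<comment> \<open>A connected set with two distinct points has no isolated point; removing
    finitely many points then preserves limit points.\<close>
  ultimately have "z islimpt path_image g"
    using z connected_imp_perfect[of "path_image g" z] by fastforce
  moreover have "path_image g \<subseteq> {pathstart g, pathfinish g} \<union> (path_image g - {pathstart g, pathfinish g})"
    by auto
  ultimately have "z islimpt {pathstart g, pathfinish g} \<union> (path_image g - {pathstart g, pathfinish g})"
    by (rule islimpt_subset)
  then have "z islimpt path_image g - {pathstart g, pathfinish g}"
    using iffD1[OF islimpt_Un_finite] by (metis finite.emptyI finite.insertI)
  then show "z \<in> closure (path_image g - {pathstart g, pathfinish g})"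
    by (simp add: closure_def)
qed

text \<open>\<open>S\<close> and \<open>T\<close> are the two arcs into which the ends of the chord \<open>P\<close> cut a Jordan curve, and \<open>Q\<close>
  is a chord from \<open>x\<close> to \<open>y\<close> without its ends, on the same side \<open>U\<close> as \<open>P\<close>. A point of \<open>U\<close> and a
  point of \<open>W\<close> can be joined near \<open>x\<close> without meeting \<open>T \<union> P\<close>, and along \<open>Q\<close>, near \<open>y\<close> and through
  \<open>W\<close> without meeting \<open>S \<union> P\<close>. As \<open>(S \<union> P) \<inter> (T \<union> P) = P\<close> is connected, Janiszewski's theorem
  joins them in the complement of the curve.\<close>

lemma no_crossing_chord:
  fixes S T P Q U W :: "complex set"
  assumes cpt: "compact S" "compact T" "compact P" and P: "connected P" "S \<inter> T \<subseteq> P"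
    and UW: "U \<union> W = - (S \<union> T)" "U \<inter> W = {}" "open U" "open W" "connected W"
    and clW: "x \<in> closure W" "y \<in> closure W"
    and PU: "P \<subseteq> S \<union> T \<union> U"
    and Q: "connected Q" "Q \<subseteq> U" "x \<in> closure Q" "y \<in> closure Q" "P \<inter> Q = {}"
    and xy: "x \<notin> T \<union> P" "y \<notin> S \<union> P"
  shows False
proof -
  have near: "\<exists>u\<in>Q. \<exists>w\<in>W. connected_component (- A) u w"
    if z: "closed A" "z \<notin> A" "z \<in> closure Q" "z \<in> closure W" for A z
  proof -
    obtain r where r: "r > 0" "ball z r \<subseteq> - A"
      using z(1,2) openE[of "- A" z] by (auto simp: open_Compl)
    obtain u w where "u \<in> Q" "u \<in> ball z r" "w \<in> W" "w \<in> ball z r"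
      using z(3,4) r(1) unfolding closure_approachable by (metis dist_commute mem_ball)
    then show ?thesis
      using r(2) unfolding connected_component_def by (metis connected_ball)
  qed
  obtain u w where u: "u \<in> Q" "w \<in> W" "connected_component (- (T \<union> P)) u w"
    using near[of "T \<union> P" x] cpt clW Q xy by (auto simp: compact_imp_closed closed_Un)
  obtain u' w' where u': "u' \<in> Q" "w' \<in> W" "connected_component (- (S \<union> P)) u' w'"
    using near[of "S \<union> P" y] cpt clW Q xy by (auto simp: compact_imp_closed closed_Un)
  have "Q \<subseteq> - (S \<union> P)" "W \<subseteq> - (S \<union> P)"
    using Q UW PU by auto
  then have "connected_component (- (S \<union> P)) u u'" "connected_component (- (S \<union> P)) w' w"
    unfolding connected_component_def using Q(1) UW(5) u u' by blast+
  then have "connected_component (- (S \<union> P)) u w"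
    using u'(3) connected_component_trans by metis
  moreover have "(S \<union> P) \<inter> (T \<union> P) = P"
    using P(2) by auto
  ultimately have "connected_component (- ((S \<union> P) \<union> (T \<union> P))) u w"
    using Janiszewski[of "S \<union> P" "T \<union> P" u w] cpt P(1) u(3)
    by (simp add: compact_Un compact_imp_closed closed_Un)
  then obtain D where D: "connected D" "D \<subseteq> - ((S \<union> P) \<union> (T \<union> P))" "u \<in> D" "w \<in> D"
    unfolding connected_component_def by blast
  have "D \<subseteq> U \<union> W"
    using D(2) UW(1) by auto
  moreover have "U \<inter> D \<noteq> {}" "W \<inter> D \<noteq> {}"
    using D u Q(2) by auto
  ultimately show False
    using connectedD[OF D(1) UW(3,4)] UW(2) by auto
qed

text \<open>Take any arc in \<open>M\<close> from \<open>A\<close> to \<open>B\<close>, cut it at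
  its last point in \<open>A\<close>, and then at the first point in \<open>B\<close> after
  that.\<close>

lemma arc_between_closed_sets:
  fixes M :: "'a::euclidean_space set"
  assumes M: "path_connected M" and AB: "closed A" "closed B" "A \<inter> B = {}"
    and ne: "M \<inter> A \<noteq> {}" "M \<inter> B \<noteq> {}"
  obtains g where "arc g" "path_image g \<subseteq> M" "path_image g \<inter> A = {pathstart g}"
    "path_image g \<inter> B = {pathfinish g}"
proof -
  obtain a b where ab: "a \<in> M" "a \<in> A" "b \<in> M" "b \<in> B"
    using ne by auto
  then have "a \<noteq> b" using AB by auto
  then obtain h where h: "arc h" "path_image h \<subseteq> M" "pathstart h = a" "pathfinish h = b"
    using M ab path_connected_arcwise[of M] by metis
  have cont: "continuous_on {0..1} h"
    using h(1) by (simp add: arc_def path_def)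
  define X where "X = {0..1} \<inter> h -` A"
  have "closed X"
    unfolding X_def by (intro continuous_closed_preimage cont AB closed_atLeastAtMost)
  then have "compact X"
    unfolding X_def by (metis bounded_Int bounded_closed_interval box_real(2) compact_eq_bounded_closed)
  moreover have "0 \<in> X"
    using h ab by (auto simp: X_def pathstart_def)
  ultimately obtain s where s: "s \<in> X" "\<And>t. t \<in> X \<Longrightarrow> t \<le> s"
    using compact_attains_sup[of X] by auto
  define Y where "Y = {s..1} \<inter> h -` B"
  have s01: "0 \<le> s" "s \<le> 1" "h s \<in> A"
    using s by (auto simp: X_def)
  have "continuous_on {s..1} h"
    using cont s01 continuous_on_subset by (metis atLeastatMost_subset_iff order_refl)
  then have "closed Y"
    unfolding Y_def by (intro continuous_closed_preimage AB closed_atLeastAtMost)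
  then have "compact Y"
    unfolding Y_def by (metis bounded_Int bounded_closed_interval box_real(2) compact_eq_bounded_closed)
  moreover have "1 \<in> Y"
    using h ab s01 by (auto simp: Y_def pathfinish_def)
  ultimately obtain t where t: "t \<in> Y" "\<And>r. r \<in> Y \<Longrightarrow> t \<le> r"
    using compact_attains_inf[of Y] by auto
  have t01: "s \<le> t" "t \<le> 1" "h t \<in> B"
    using t by (auto simp: Y_def)
  then have "s \<noteq> t"
    using AB s01 by auto
  have img: "path_image (subpath s t h) = h ` {s..t}"
    using t01 by (simp add: path_image_subpath)
  show thesis
  proof
    show "arc (subpath s t h)"
      using h(1) s01 t01 \<open>s \<noteq> t\<close> by (intro arc_subpath_arc) auto
    show "path_image (subpath s t h) \<subseteq> M"
      unfolding img using h(2) s01 t01 by (auto simp: path_image_def)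
    have "r = s" if "s \<le> r" "r \<le> t" "h r \<in> A" for r
      using s(2)[of r] that s01 t01 by (auto simp: X_def)
    then show "path_image (subpath s t h) \<inter> A = {pathstart (subpath s t h)}"
      unfolding img using s01 t01 by fastforce
    have "r = t" if "s \<le> r" "r \<le> t" "h r \<in> B" for r
      using t(2)[of r] that s01 t01 by (auto simp: Y_def)
    then show "path_image (subpath s t h) \<inter> B = {pathfinish (subpath s t h)}"
      unfolding img using s01 t01 by fastforce
  qed
qed

lemma arc_split:
  fixes g :: "real \<Rightarrow> 'a::euclidean_space"
  assumes "arc g" "a \<in> path_image g"
  obtains L R where "compact L" "compact R" "L \<union> R = path_image g" "L \<inter> R = {a}"
    "pathstart g \<in> L" "pathfinish g \<in> R"
proof -
  obtain s where s: "0 \<le> s" "s \<le> 1" "a = g s"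
    using assms(2) by (auto simp: path_image_def)
  have cont: "continuous_on {0..1} g" and inj: "inj_on g {0..1}"
    using assms(1) by (auto simp: arc_def path_def)
  show thesis
  proof
    show "compact (g ` {0..s})" "compact (g ` {s..1})"
      using cont s by (auto intro!: compact_continuous_image intro: continuous_on_subset)
    have "{0..1} = {0..s} \<union> {s..1}" using s by auto
    then show "g ` {0..s} \<union> g ` {s..1} = path_image g"
      by (simp add: path_image_def image_Un)
    have "{0..s} \<inter> {s..1} = {s}" using s by auto
    moreover have "g ` ({0..s} \<inter> {s..1}) = g ` {0..s} \<inter> g ` {s..1}"
      by (rule inj_on_image_Int[OF inj]) (use s in auto)
    ultimately show "g ` {0..s} \<inter> g ` {s..1} = {a}"
      using s by auto
    show "pathstart g \<in> g ` {0..s}" "pathfinish g \<in> g ` {s..1}"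
      using s by (auto simp: pathstart_def pathfinish_def)
  qed
qed

section \<open>Chords of a cycle of blobs\<close>

text \<open>The blobs \<open>K i\<close> are images of branch sets and \<open>F i j\<close> is the image of an edge between two of
  them; consecutive blobs, cyclically, are adjacent. Below, \<open>v i\<close> is the point where the edge coming
  from the preceding blob enters \<open>K i\<close>, and the arcs \<open>seg i\<close> from \<open>v i\<close> to \<open>v (i + 1)\<close> form a Jordan
  curve \<open>C\<close>.\<close>

locale blob_cycle =
  fixes n :: nat and R :: "nat \<Rightarrow> nat \<Rightarrow> bool"
    and K :: "nat \<Rightarrow> complex set" and F :: "nat \<Rightarrow> nat \<Rightarrow> complex set"
  assumes n3: "n \<ge> 3"
    and R_Suc: "Suc i < n \<Longrightarrow> R i (Suc i)" and R_last: "R (n - 1) 0"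
    and K: "i < n \<Longrightarrow> compact (K i)" "i < n \<Longrightarrow> path_connected (K i)"
    and K_disj: "i < n \<Longrightarrow> j < n \<Longrightarrow> i \<noteq> j \<Longrightarrow> K i \<inter> K j = {}"
    and F: "i < n \<Longrightarrow> j < n \<Longrightarrow> i \<noteq> j \<Longrightarrow> R i j \<Longrightarrow> compact (F i j)"
      "i < n \<Longrightarrow> j < n \<Longrightarrow> i \<noteq> j \<Longrightarrow> R i j \<Longrightarrow> path_connected (F i j)"
    and FK: "i < n \<Longrightarrow> j < n \<Longrightarrow> i \<noteq> j \<Longrightarrow> R i j \<Longrightarrow> F i j \<inter> K i \<noteq> {}"
      "i < n \<Longrightarrow> j < n \<Longrightarrow> i \<noteq> j \<Longrightarrow> R i j \<Longrightarrow> \<exists>v. F i j \<inter> K j = {v}"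
      "i < n \<Longrightarrow> j < n \<Longrightarrow> i \<noteq> j \<Longrightarrow> R i j \<Longrightarrow> t < n \<Longrightarrow> t \<noteq> i \<Longrightarrow> t \<noteq> j \<Longrightarrow> F i j \<inter> K t = {}"
    and FF: "i < n \<Longrightarrow> j < n \<Longrightarrow> i \<noteq> j \<Longrightarrow> R i j \<Longrightarrow> k < n \<Longrightarrow> l < n \<Longrightarrow> k \<noteq> l \<Longrightarrow> R k l \<Longrightarrow>
      {i, j} \<noteq> {k, l} \<Longrightarrow> F i j \<inter> F k l \<subseteq> (K i \<union> K j) \<inter> (K k \<union> K l)"
begin

section \<open>The Jordan curve through the blobs\<close>

definition sc :: "nat \<Rightarrow> nat" where "sc i = (if Suc i = n then 0 else Suc i)"

definition pr :: "nat \<Rightarrow> nat" where "pr i = (if i = 0 then n - 1 else i - 1)"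

lemma sc_less: "i < n \<Longrightarrow> sc i < n" and sc_neq: "i < n \<Longrightarrow> sc i \<noteq> i"
  and R_sc: "i < n \<Longrightarrow> R i (sc i)"
  and sc_inj: "i < n \<Longrightarrow> j < n \<Longrightarrow> sc i = sc j \<Longrightarrow> i = j"
  and sc_sc: "i < n \<Longrightarrow> sc (sc i) \<noteq> i"
  and pr_sc: "i < n \<Longrightarrow> pr (sc i) = i"
  and pr_less: "i < n \<Longrightarrow> pr i < n" and sc_pr: "i < n \<Longrightarrow> sc (pr i) = i"
  using n3 R_Suc[of i] R_last by (auto simp: sc_def pr_def split: if_splits)

definition v :: "nat \<Rightarrow> complex" where "v i = (THE z. F (pr i) i \<inter> K i = {z})"

lemma v: "i < n \<Longrightarrow> F (pr i) i \<inter> K i = {v i}"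
proof -
  assume i: "i < n"
  have "\<exists>!z. F (pr i) i \<inter> K i = {z}"
    using FK(2)[of "pr i" i] pr_less[OF i] sc_pr[OF i] sc_neq[of "pr i"] R_sc[of "pr i"] i by auto
  then show ?thesis
    unfolding v_def by (rule theI')
qed

lemma v_in: "i < n \<Longrightarrow> v i \<in> K i"
  and v_F: "i < n \<Longrightarrow> F i (sc i) \<inter> K (sc i) = {v (sc i)}"
  using v[of i] v[of "sc i"] by (auto simp: pr_sc sc_less)

lemma v_inj: "i < n \<Longrightarrow> j < n \<Longrightarrow> v i = v j \<Longrightarrow> i = j"
  using v_in K_disj by (metis disjoint_iff)

lemma ex_seg: "i < n \<Longrightarrow> \<exists>g. arc g \<and> path_image g \<subseteq> K i \<union> F i (sc i) \<and> pathstart g = v i \<and> pathfinish g = v (sc i)"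
proof -
  assume i: "i < n"
  have s: "sc i < n" "i \<noteq> sc i" "R i (sc i)"
    using i sc_less sc_neq[OF i] R_sc by auto
  have "path_connected (K i \<union> F i (sc i))"
    by (intro path_connected_Un K F i s) (use FK(1)[OF i s] in auto)
  moreover have "v i \<noteq> v (sc i)"
    using v_inj[of i "sc i"] i s by auto
  moreover have "v i \<in> K i \<union> F i (sc i)" "v (sc i) \<in> K i \<union> F i (sc i)"
    using v_in[OF i] v_F[OF i] by auto
  ultimately show ?thesis
    unfolding path_connected_arcwise by metis
qed

definition seg :: "nat \<Rightarrow> real \<Rightarrow> complex" where
  "seg i = (SOME g. arc g \<and> path_image g \<subseteq> K i \<union> F i (sc i) \<and> pathstart g = v i \<and> pathfinish g = v (sc i))"

lemma seg:
  assumes "i < n"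
  shows "arc (seg i)" "path_image (seg i) \<subseteq> K i \<union> F i (sc i)" "pathstart (seg i) = v i" "pathfinish (seg i) = v (sc i)"
  using someI_ex[OF ex_seg[OF assms]] unfolding seg_def by auto

abbreviation seg_img :: "nat \<Rightarrow> complex set" where "seg_img i \<equiv> path_image (seg i)"

lemma v_seg: "i < n \<Longrightarrow> v i \<in> seg_img i" "i < n \<Longrightarrow> v (sc i) \<in> seg_img i"
  using seg(3,4)[of i] pathstart_in_path_image[of "seg i"] pathfinish_in_path_image[of "seg i"] by auto

lemma K_uniq: "z \<in> K i \<Longrightarrow> z \<in> K j \<Longrightarrow> i < n \<Longrightarrow> j < n \<Longrightarrow> i = j"
  using K_disj[of i j] by auto

lemma F_sc_K: "z \<in> F i (sc i) \<Longrightarrow> z \<in> K t \<Longrightarrow> i < n \<Longrightarrow> t < n \<Longrightarrow> t \<noteq> i \<Longrightarrow> t = sc i \<and> z = v t"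
  using FK(3)[of i "sc i" t] v_F[of i] sc_less[of i] sc_neq[of i] R_sc[of i] by (cases "t = sc i") auto

lemma seg_img_K: "z \<in> seg_img i \<Longrightarrow> z \<in> K t \<Longrightarrow> i < n \<Longrightarrow> t < n \<Longrightarrow> t \<noteq> i \<Longrightarrow> t = sc i \<and> z = v t"
  using seg(2)[of i] F_sc_K[of z i t] K_uniq[of z i t] by auto

text \<open>A common point outside both own blobs lies on two different edges, hence by
  \<open>FF\<close> in both successor blobs, which injectivity of \<open>sc\<close> forbids. A
  common point inside one of the own blobs must be the single point where the preceding edge enters
  it.\<close>

lemma seg_img_inter:
  assumes ij: "i < n" "j < n" "i \<noteq> j" and z: "z \<in> seg_img i" "z \<in> seg_img j"
  shows "j = sc i \<and> z = v j \<or> i = sc j \<and> z = v i"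
proof -
  have KF: "z \<in> K i \<Longrightarrow> ?thesis" "z \<in> K j \<Longrightarrow> ?thesis"
    using seg_img_K[OF z(2)] seg_img_K[OF z(1)] ij by auto
  show ?thesis
  proof (cases "z \<in> K i \<or> z \<in> K j")
    case True
    then show ?thesis using KF by auto
  next
    case False
    then have zF: "z \<in> F i (sc i)" "z \<in> F j (sc j)"
      using seg(2)[of i] seg(2)[of j] ij z by auto
    have s: "sc i < n" "i \<noteq> sc i" "R i (sc i)" "sc j < n" "j \<noteq> sc j" "R j (sc j)"
      using ij sc_less sc_neq[of i] sc_neq[of j] R_sc by auto
    \<comment> \<open>This uses \<open>n\<close> at least 3: on a cycle of length two the same pair
      would occur for both indices, and \<open>FF\<close> would not apply.\<close>
    have "{i, sc i} \<noteq> {j, sc j}"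
      using ij sc_sc[of i] by (auto simp: doubleton_eq_iff)
    then have "z \<in> (K i \<union> K (sc i)) \<inter> (K j \<union> K (sc j))"
      using FF[of i "sc i" j "sc j"] ij s zF by auto
    then have "z \<in> K (sc i)" "z \<in> K (sc j)"
      using False by auto
    then have "sc i = sc j" using K_uniq s by auto
    then show ?thesis using sc_inj ij by auto
  qed
qed

lemma seg_img_inter_less:
  assumes "i < j" "j < n" "z \<in> seg_img i" "z \<in> seg_img j"
  shows "j = Suc i \<and> z = v j \<or> i = 0 \<and> j = n - 1 \<and> z = v i"
  using seg_img_inter[of i j z] assms by (auto simp: sc_def split: if_splits)

definition C :: "complex set" where "C = (\<Union>i<n. seg_img i)"

lemma chain_arc:
  "Suc m < n \<Longrightarrow> \<exists>g. arc g \<and> pathstart g = v 0 \<and> pathfinish g = v (Suc m) \<and> path_image g = (\<Union>i\<le>m. seg_img i)"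
proof (induction m)
  case 0
  then show ?case using seg[of 0] by (intro exI[of _ "seg 0"]) (auto simp: sc_def)
next
  case (Suc m)
  then obtain g where g: "arc g" "pathstart g = v 0" "pathfinish g = v (Suc m)" "path_image g = (\<Union>i\<le>m. seg_img i)"
    by auto
  have "path_image g \<inter> seg_img (Suc m) \<subseteq> {v (Suc m)}"
  proof
    fix z assume z: "z \<in> path_image g \<inter> seg_img (Suc m)"
    then obtain i where "i \<le> m" "z \<in> seg_img i" using g(4) by auto
    then show "z \<in> {v (Suc m)}"
      using seg_img_inter_less[of i "Suc m" z] z Suc.prems by auto
  qed
  then have "arc (g +++ seg (Suc m))"
    using g seg[of "Suc m"] Suc.prems by (intro arc_join) auto
  moreover have "path_image (g +++ seg (Suc m)) = (\<Union>i\<le>Suc m. seg_img i)"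
    using g seg[of "Suc m"] Suc.prems by (subst path_image_join) (auto simp: atMost_Suc)
  ultimately show ?case
    using g seg[of "Suc m"] Suc.prems by (intro exI[of _ "g +++ seg (Suc m)"]) (auto simp: sc_def)
qed

lemma C_loop: obtains c where "simple_path c" "pathfinish c = pathstart c" "path_image c = C"
proof -
  \<comment> \<open>The chain stops at segment \<open>n - 2\<close>: the last segment meets it in
    both of its ends and closes the loop.\<close>
  obtain g where g: "arc g" "pathstart g = v 0" "pathfinish g = v (n - 1)" "path_image g = (\<Union>i\<le>n-2. seg_img i)"
    using chain_arc[of "n - 2"] n3 by (auto simp: numeral_2_eq_2 Suc_diff_Suc)
  have l: "n - 1 < n" "sc (n - 1) = 0" using n3 by (auto simp: sc_def)
  note a = seg[OF l(1), unfolded l(2)]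
  have "path_image g \<inter> seg_img (n - 1) \<subseteq> {v 0, v (n - 1)}"
  proof
    fix z assume z: "z \<in> path_image g \<inter> seg_img (n - 1)"
    then obtain i where "i \<le> n - 2" "z \<in> seg_img i" using g(4) by auto
    then have "n - 1 = Suc i \<and> z = v (n - 1) \<or> i = 0 \<and> z = v i"
      using seg_img_inter_less[of i "n - 1" z] z n3 by auto
    then show "z \<in> {v 0, v (n - 1)}"
      by auto
  qed
  then have "simple_path (g +++ seg (n - 1))"
    using g a by (intro simple_path_join_loop) auto
  moreover have "{..<n} = insert (n - 1) {..n-2}" using n3 by auto
  then have "path_image (g +++ seg (n - 1)) = C"
    using g a by (subst path_image_join) (auto simp: C_def)
  moreover have "pathfinish (g +++ seg (n - 1)) = pathstart (g +++ seg (n - 1))"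
    using g a by auto
  ultimately show thesis using that by blast
qed

section \<open>Chords of the curve and their sides\<close>

definition chord_arc :: "nat \<Rightarrow> nat \<Rightarrow> (real \<Rightarrow> complex) \<Rightarrow> bool" where
  "chord_arc i j P \<longleftrightarrow> arc P \<and> path_image P \<subseteq> K i \<union> F i j \<union> K j \<and>
    path_image P \<inter> C = {pathstart P, pathfinish P} \<and>
    pathstart P \<in> K i \<inter> seg_img i \<and> pathfinish P \<in> K j \<inter> seg_img j"

lemma compact_seg_img: "i < n \<Longrightarrow> compact (seg_img i)"
  by (simp add: seg(1) arc_imp_path compact_path_image)

text \<open>Take an arc between the two segments inside \<open>K i\<close>, \<open>F i j\<close> and
  \<open>K j\<close>. Segments meet this region only inside the two blobs, and a foreign segment
  reaching \<open>K i\<close> does so at \<open>v i\<close>, which lies on \<open>seg i\<close> as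
  well. The ends of the chord are thus not prescribed points; knowing their blobs is enough to
  locate them on the curve.\<close>

lemma ex_chord:
  assumes ij: "i < n" "j < n" "i \<noteq> j" "R i j" "j \<noteq> sc i" "i \<noteq> sc j"
  obtains P where "chord_arc i j P"
proof -
  let ?M = "K i \<union> F i j \<union> K j"
  have disj: "seg_img i \<inter> seg_img j = {}"
    using seg_img_inter[of i j] ij by auto
  have Fij: "F i j \<inter> K i \<noteq> {}" "F i j \<inter> K j \<noteq> {}"
    using FK(1,2)[of i j] ij by auto
  have "path_connected ?M"
    by (intro path_connected_Un K F ij) (use Fij in auto)
  moreover have "?M \<inter> seg_img i \<noteq> {}" "?M \<inter> seg_img j \<noteq> {}"
    using v_in v_seg ij by blast+
  ultimately obtain P where P: "arc P" "path_image P \<subseteq> ?M" "path_image P \<inter> seg_img i = {pathstart P}"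
    "path_image P \<inter> seg_img j = {pathfinish P}"
    using arc_between_closed_sets[of ?M "seg_img i" "seg_img j"] disj compact_seg_img ij compact_imp_closed by metis
  have in_K: "z \<in> K i \<or> z \<in> K j" if z: "z \<in> ?M" "t < n" "z \<in> seg_img t" for z t
  proof (rule ccontr)
    assume nK: "\<not> (z \<in> K i \<or> z \<in> K j)"
    then have zF: "z \<in> F i j" using z by auto
    show False
    proof (cases "z \<in> K t")
      case True
      then show False using FK(3)[of i j t] zF nK ij z(2) by (cases "t = i \<or> t = j") auto
    next
      case False
      then have "z \<in> F t (sc t)" using seg(2)[OF z(2)] z by auto
      moreover have "{i, j} \<noteq> {t, sc t}" using ij by (auto simp: doubleton_eq_iff)
      ultimately show False
        using FF[of i j t "sc t"] ij z(2) sc_less sc_neq[of t] R_sc zF nK by auto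
    qed
  qed
  have in_ends: "z \<in> seg_img i \<or> z \<in> seg_img j" if z: "z \<in> ?M" "t < n" "z \<in> seg_img t" for z t
    using in_K[OF z]
  proof
    assume "z \<in> K i"
    then show ?thesis using seg_img_K[OF z(3), of i] z v_seg(1) ij by (cases "t = i") auto
  next
    assume "z \<in> K j"
    then show ?thesis using seg_img_K[OF z(3), of j] z v_seg(1) ij by (cases "t = j") auto
  qed
  have ends: "pathstart P \<in> seg_img i" "pathfinish P \<in> seg_img j" "pathstart P \<in> ?M" "pathfinish P \<in> ?M"
    using P by auto
  have "pathstart P \<in> K i"
    using in_K[OF ends(3) ij(1) ends(1)] seg_img_K[OF ends(1), of j] ij by auto
  moreover have "pathfinish P \<in> K j"
    using in_K[OF ends(4) ij(2) ends(2)] seg_img_K[OF ends(2), of i] ij by auto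
  moreover have "path_image P \<inter> C = {pathstart P, pathfinish P}"
  proof
    show "path_image P \<inter> C \<subseteq> {pathstart P, pathfinish P}"
      using in_ends P unfolding C_def by blast
    show "{pathstart P, pathfinish P} \<subseteq> path_image P \<inter> C"
      using ends ij unfolding C_def by auto
  qed
  ultimately show thesis
    using that P ends unfolding chord_arc_def by blast
qed

definition endless :: "(real \<Rightarrow> complex) \<Rightarrow> complex set" where
  "endless g = path_image g - {pathstart g, pathfinish g}"

text \<open>Reduction to \<open>no_crossing_chord\<close>: the order of the blobs along the curve
  shows that the ends of \<open>P\<close> separate those of \<open>Q\<close>. The chords are
  disjoint because their four blobs are, and by \<open>FF\<close> the edges \<open>F i j\<close> and
  \<open>F k l\<close> could meet only inside a common blob.\<close>

lemma chords_differ: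
  assumes ord: "i < k" "k < j" "j < l" "l < n" and R: "R i j" "R k l"
    and P: "chord_arc i j P" and Q: "chord_arc k l Q"
    and UW: "U \<union> W = - C" "U \<inter> W = {}" "open U" "open W" "connected W" "C \<subseteq> closure W"
    and sides: "endless P \<subseteq> U" "endless Q \<subseteq> U"
  shows False
proof -
  let ?a = "pathstart P" let ?b = "pathfinish P"
  let ?x = "pathstart Q" let ?y = "pathfinish Q"
  have a: "?a \<in> K i" "?a \<in> seg_img i" and b: "?b \<in> K j" "?b \<in> seg_img j"
    and x: "?x \<in> K k" "?x \<in> seg_img k" and y: "?y \<in> K l" "?y \<in> seg_img l"
    using P Q by (auto simp: chord_arc_def)
  have less: "i < n" "j < n" "k < n" using ord by auto
  obtain Li Ri where i: "compact Li" "compact Ri" "Li \<union> Ri = seg_img i" "Li \<inter> Ri = {?a}" "v i \<in> Li" "v (Suc i) \<in> Ri"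
    using arc_split[OF seg(1)[OF less(1)] a(2)] seg(3,4)[OF less(1)] ord by (auto simp: sc_def)
  obtain Lj Rj where j: "compact Lj" "compact Rj" "Lj \<union> Rj = seg_img j" "Lj \<inter> Rj = {?b}" "v j \<in> Lj" "v (Suc j) \<in> Rj"
    using arc_split[OF seg(1)[OF less(2)] b(2)] seg(3,4)[OF less(2)] ord by (auto simp: sc_def)
  \<comment> \<open>\<open>S\<close> runs from the start of \<open>P\<close> through blob
    \<open>k\<close> to the finish of \<open>P\<close>; \<open>T\<close> continues through blob
    \<open>l\<close> and past \<open>v 0\<close> back to the start.\<close>
  define S where "S = Ri \<union> (\<Union>t\<in>{i<..<j}. seg_img t) \<union> Lj"
  define T where "T = (\<Union>t\<in>{..<i} \<union> {j<..<n}. seg_img t) \<union> Li \<union> Rj"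
  have sub: "Li \<subseteq> seg_img i" "Ri \<subseteq> seg_img i" "Lj \<subseteq> seg_img j" "Rj \<subseteq> seg_img j"
    using i(3) j(3) by auto
  have "{..<n} = {..<i} \<union> {j<..<n} \<union> {i<..<j} \<union> {i, j}"
    using ord by auto
  then have "C = S \<union> T"
    using i(3) j(3) unfolding C_def S_def T_def by auto
  have ST: "compact S" "compact T"
    unfolding S_def T_def using i j compact_seg_img ord by (auto intro!: compact_Un compact_UN)
  have int: "t = Suc s \<and> z = v t \<or> s = 0 \<and> t = n - 1 \<and> z = v s" if "z \<in> seg_img s" "z \<in> seg_img t" "s < t" "t < n" for z s t
    using seg_img_inter_less that by blast
  have STP: "S \<inter> T \<subseteq> {?a, ?b}"
  proof
    fix z assume z: "z \<in> S \<inter> T"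
    then have zT: "z \<in> Li \<or> z \<in> Rj \<or> (\<exists>t<i. z \<in> seg_img t) \<or> (\<exists>t. j < t \<and> t < n \<and> z \<in> seg_img t)"
      unfolding T_def by auto
    from z consider "z \<in> Ri" | t where "i < t" "t < j" "z \<in> seg_img t" | "z \<in> Lj"
      unfolding S_def by auto
    then show "z \<in> {?a, ?b}"
    proof cases
      case 1
      then have "z \<in> seg_img i" using sub by auto
      then have "z \<notin> Rj" using int[of z i j] ord sub(4) by auto
      moreover have "z = v i" if "t < i" "z \<in> seg_img t" for t
        using int[of z t i] that \<open>z \<in> seg_img i\<close> ord by auto
      moreover have "z = v i" if "j < t" "t < n" "z \<in> seg_img t" for t
        using int[of z i t] that \<open>z \<in> seg_img i\<close> ord by auto
      ultimately have "z \<in> Li" using zT i(5) by auto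
      then show ?thesis using 1 i(4) by auto
    next
      case 2
      have "z \<notin> seg_img s" if "s < i" for s
        using int[of z s t] that 2 ord by auto
      moreover have "z \<notin> seg_img s" if "j < s" "s < n" for s
        using int[of z t s] that 2 ord by auto
      ultimately consider "z \<in> Li" | "z \<in> Rj" using zT by auto
      then show ?thesis
      proof cases
        case 1
        then have "z = v (Suc i)" using int[OF subsetD[OF sub(1) 1] 2(3) 2(1)] 2 ord by auto
        then show ?thesis using 1 i(4,6) by auto
      next
        case z: 2
        then have "z = v j" using int[OF 2(3) subsetD[OF sub(4) z] 2(2)] 2 ord by auto
        then show ?thesis using z j(4,5) by auto
      qed
    next
      case 3
      then have "z \<in> seg_img j" using sub by auto
      then have "z \<notin> Li" using int[of z i j] ord sub(1) by auto
      moreover have "z \<notin> seg_img t" if "t < i" for t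
        using int[of z t j] that \<open>z \<in> seg_img j\<close> ord by auto
      moreover have "z = v (Suc j)" if "j < t" "t < n" "z \<in> seg_img t" for t
        using int[of z j t] that \<open>z \<in> seg_img j\<close> ord by auto
      ultimately have "z \<in> Rj" using zT j(6) by auto
      then show ?thesis using 3 j(4) by auto
    qed
  qed
  \<comment> \<open>A point of blob \<open>k\<close> lies on a foreign segment only as the entry
    point \<open>v k\<close> on segment \<open>k - 1\<close>. That segment can contribute to
    \<open>T\<close> only if \<open>k - 1 = i\<close>; but \<open>v k\<close> is the end in
    \<open>Ri\<close>, so it would be the start of \<open>P\<close>, which lies in another blob. The
    argument for \<open>?y\<close> is the same with \<open>j\<close> and \<open>l\<close>.\<close>
  have xT: "?x \<notin> T"
  proof
    assume "?x \<in> T"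
    then consider t where "t < i" "?x \<in> seg_img t" | t where "j < t" "t < n" "?x \<in> seg_img t" | "?x \<in> Li" | "?x \<in> Rj"
      unfolding T_def by auto
    then have "\<exists>t. t < n \<and> (t \<le> i \<or> j \<le> t) \<and> ?x \<in> seg_img t \<and> (t = i \<longrightarrow> ?x \<in> Li)"
    proof cases
      case (1 t)
      then show ?thesis using ord by (intro exI[of _ t]) auto
    next
      case (2 t)
      then show ?thesis using ord by (intro exI[of _ t]) auto
    next
      case 3
      then show ?thesis using ord sub(1) by (intro exI[of _ i]) auto
    next
      case 4
      then show ?thesis using ord sub(4) by (intro exI[of _ j]) auto
    qed
    then obtain t where t: "t < n" "t \<le> i \<or> j \<le> t" "?x \<in> seg_img t" "t = i \<longrightarrow> ?x \<in> Li"
      by blast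
    then have "k = sc t" "?x = v k"
      using seg_img_K[OF t(3) x(1)] less ord by auto
    moreover from this have "t = i"
      using t(2) ord by (auto simp: sc_def split: if_splits)
    ultimately have "t = i" "?x = v (Suc i)"
      using ord by (auto simp: sc_def)
    then have "?x = ?a" using i(4,6) t(4) by auto
    then show False using a x K_uniq[of ?x i k] ord by auto
  qed
  have yS: "?y \<notin> S"
  proof
    assume "?y \<in> S"
    then consider t where "i < t" "t < j" "?y \<in> seg_img t" | "?y \<in> Ri" | "?y \<in> Lj"
      unfolding S_def by auto
    then have "\<exists>t. t < n \<and> (i \<le> t \<and> t \<le> j) \<and> ?y \<in> seg_img t \<and> (t = j \<longrightarrow> ?y \<in> Lj)"
    proof cases
      case (1 t)
      then show ?thesis using ord by (intro exI[of _ t]) auto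
    next
      case 2
      then show ?thesis using ord sub(2) by (intro exI[of _ i]) auto
    next
      case 3
      then show ?thesis using ord sub(3) by (intro exI[of _ j]) auto
    qed
    then obtain t where t: "t < n" "i \<le> t \<and> t \<le> j" "?y \<in> seg_img t" "t = j \<longrightarrow> ?y \<in> Lj"
      by blast
    then have "l = sc t" "?y = v l"
      using seg_img_K[OF t(3) y(1)] less ord by auto
    moreover from this have "t = j"
      using t(2) ord by (auto simp: sc_def split: if_splits)
    ultimately have "t = j" "?y = v (Suc j)"
      using ord by (auto simp: sc_def)
    then have "?y = ?b" using j(4,6) t(4) by auto
    then show False using b y K_uniq[of ?y j l] ord by auto
  qed
  have "F i j \<inter> F k l \<subseteq> (K i \<union> K j) \<inter> (K k \<union> K l)"
    using FF[of i j k l] ord R by (auto simp: doubleton_eq_iff)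
  moreover have "K i \<inter> K k = {}" "K i \<inter> K l = {}" "K j \<inter> K k = {}" "K j \<inter> K l = {}"
    using K_disj ord by auto
  moreover have "F i j \<inter> K k = {}" "F i j \<inter> K l = {}" "F k l \<inter> K i = {}" "F k l \<inter> K j = {}"
    using FK(3)[of i j] FK(3)[of k l] ord R by auto
  ultimately have "(K i \<union> F i j \<union> K j) \<inter> (K k \<union> F k l \<union> K l) = {}"
    by auto
  moreover have PQ: "path_image P \<subseteq> K i \<union> F i j \<union> K j" "path_image Q \<subseteq> K k \<union> F k l \<union> K l" "arc P" "arc Q"
    using P Q by (auto simp: chord_arc_def)
  ultimately have dPQ: "path_image P \<inter> path_image Q = {}"
    by auto
  show False
  proof (rule no_crossing_chord[of S T "path_image P" U W ?x ?y "endless Q"])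
    show "compact (path_image P)" "connected (path_image P)"
      using PQ by (auto simp: compact_path_image connected_path_image arc_imp_path)
    show "S \<inter> T \<subseteq> path_image P"
      using STP pathstart_in_path_image[of P] pathfinish_in_path_image[of P] by auto
    show "?x \<in> closure W" "?y \<in> closure W"
      using UW(6) x(2) y(2) ord less unfolding C_def by blast+
    show "path_image P \<subseteq> S \<union> T \<union> U"
      using P sides(1) unfolding chord_arc_def endless_def \<open>C = S \<union> T\<close>[symmetric] by auto
    show "connected (endless Q)"
      unfolding endless_def using PQ by (simp add: connected_simple_path_endless arc_imp_simple_path)
    show "?x \<in> closure (endless Q)" "?y \<in> closure (endless Q)"
      unfolding endless_def using arc_subset_closure_endless[OF PQ(4)] by (meson pathstart_in_path_image pathfinish_in_path_image subsetD)+
    show "path_image P \<inter> endless Q = {}"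
      using dPQ unfolding endless_def by auto
    show "?x \<notin> T \<union> path_image P" "?y \<notin> S \<union> path_image P"
      using xT yS dPQ pathstart_in_path_image[of Q] pathfinish_in_path_image[of Q] by auto
    show "U \<union> W = - (S \<union> T)"
      using UW(1) \<open>C = S \<union> T\<close> by simp
  qed (fact ST UW sides)+
qed

lemma sides_of_chords:
  "\<exists>side :: nat \<Rightarrow> nat \<Rightarrow> bool. \<forall>i j k l.
     i < k \<and> k < j \<and> j < l \<and> l < n \<and> R i j \<and> R k l \<longrightarrow> side i j \<noteq> side k l"
proof -
  obtain c where c: "simple_path c" "pathfinish c = pathstart c" "path_image c = C"
    by (rule C_loop)
  note J = Jordan_inside_outside[OF c(1,2), unfolded c(3)]
  have cl: "C \<subseteq> closure (inside C)" "C \<subseteq> closure (outside C)"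
    using J unfolding frontier_def by blast+
  \<comment> \<open>Chords for a given pair are not unique. The existential suffices: if it fails,
    every chord for the pair lies outside, and \<open>chords_differ\<close> applies to arbitrary
    chords.\<close>
  define side where "side i j \<longleftrightarrow> (\<exists>P. chord_arc i j P \<and> endless P \<subseteq> inside C)" for i j
  have dich: "endless P \<subseteq> inside C \<or> endless P \<subseteq> outside C" if P: "chord_arc i j P" for i j P
  proof -
    have "connected (endless P)"
      unfolding endless_def using P
      by (simp add: connected_simple_path_endless arc_imp_simple_path chord_arc_def)
    moreover have io: "endless P \<subseteq> inside C \<union> outside C"
      using P unfolding endless_def chord_arc_def inside_Un_outside by auto
    moreover have "open (inside C)" "open (outside C)" "inside C \<inter> outside C \<inter> endless P = {}"
      using J by auto
    ultimately have "inside C \<inter> endless P = {} \<or> outside C \<inter> endless P = {}"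
      by (intro connectedD)
    then show ?thesis
      using io by blast
  qed
  show ?thesis
  proof (intro exI[of _ side] allI impI)
    fix i j k l assume h: "i < k \<and> k < j \<and> j < l \<and> l < n \<and> R i j \<and> R k l"
    then have o: "i < k" "k < j" "j < l" "l < n" and R: "R i j" "R k l"
      by auto
    have "i < n" "j < n" "i \<noteq> j" "j \<noteq> sc i" "i \<noteq> sc j"
      using o by (auto simp: sc_def)
    then obtain P where P: "chord_arc i j P"
      using ex_chord R by metis
    have "k < n" "k \<noteq> l" "l \<noteq> sc k" "k \<noteq> sc l"
      using o by (auto simp: sc_def)
    then obtain Q where Q: "chord_arc k l Q"
      using ex_chord R o(4) by metis
    have D1: False if "chord_arc i j P" "chord_arc k l Q" "endless P \<subseteq> inside C" "endless Q \<subseteq> inside C" for P Q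
      by (rule chords_differ[OF o R that(1,2) _ _ _ _ _ cl(2) that(3,4)]) (use J in simp_all)
    have D2: False if "chord_arc i j P" "chord_arc k l Q" "endless P \<subseteq> outside C" "endless Q \<subseteq> outside C" for P Q
      by (rule chords_differ[OF o R that(1,2) _ _ _ _ _ cl(1) that(3,4)]) (use J in \<open>simp_all add: Un_commute Int_commute\<close>)
    show "side i j \<noteq> side k l"
    proof
      assume eq: "side i j = side k l"
      show False
      proof (cases "side i j")
        case True
        then show False using eq D1 unfolding side_def by blast
      next
        case False
        then have "endless P \<subseteq> outside C" "endless Q \<subseteq> outside C"
          using dich P Q eq unfolding side_def by blast+
        then show False using D2[OF P Q] by blast
      qed
    qed
  qed
qed

end

section \<open>Minors\<close>

text \<open>Simple graphs are symmetric irreflexive relations here, so \<open>card A\<close> is twice the number of edges.\<close>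

definition linked :: "('a \<times> 'a) set \<Rightarrow> 'a set \<Rightarrow> bool" where
  "linked A B \<longleftrightarrow> (\<forall>S. S \<subseteq> B \<longrightarrow> S \<noteq> {} \<longrightarrow> S \<noteq> B \<longrightarrow> A \<inter> S \<times> (B - S) \<noteq> {})"

text \<open>Connectedness of the branch sets is phrased by cuts through \<open>linked\<close>, so
  that enlarging or pulling back branch sets requires no handling of paths.\<close>

definition minor_model ::
    "nat \<Rightarrow> (nat \<Rightarrow> nat \<Rightarrow> bool) \<Rightarrow> ('a \<times> 'a) set \<Rightarrow> (nat \<Rightarrow> 'a set) \<Rightarrow> bool" where
  "minor_model n R A B \<longleftrightarrow>
     (\<forall>i<n. B i \<noteq> {} \<and> linked A (B i)) \<and>
     (\<forall>i<n. \<forall>j<n. i \<noteq> j \<longrightarrow> B i \<inter> B j = {}) \<and>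
     (\<forall>i<n. \<forall>j<n. i \<noteq> j \<and> R i j \<longrightarrow> A \<inter> B i \<times> B j \<noteq> {})"

definition K5_minor :: "('a \<times> 'a) set \<Rightarrow> bool" where
  "K5_minor A \<longleftrightarrow> (\<exists>B. minor_model 5 (\<lambda>_ _. True) A B)"

text \<open>Parity is the bipartition. In this numbering 0, ..., 5 is a Hamiltonian cycle of the
  pattern, as \<open>blob_cycle\<close> requires.\<close>

definition K33_minor :: "('a \<times> 'a) set \<Rightarrow> bool" where
  "K33_minor A \<longleftrightarrow> (\<exists>B. minor_model 6 (\<lambda>i j. odd (i + j)) A B)"

lemma linkedE:
  assumes "linked A B" "S \<subseteq> B" "S \<noteq> {}" "S \<noteq> B"
  obtains a b where "(a, b) \<in> A" "a \<in> S" "b \<in> B" "b \<notin> S"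
  using assms unfolding linked_def by blast

lemma linkedI:
  assumes "\<And>S. S \<subseteq> B \<Longrightarrow> S \<noteq> {} \<Longrightarrow> S \<noteq> B \<Longrightarrow> \<exists>a b. (a, b) \<in> A \<and> a \<in> S \<and> b \<in> B \<and> b \<notin> S"
  shows "linked A B"
  unfolding linked_def using assms by blast

lemma linked_empty [simp]: "linked A {}" and linked_single [simp]: "linked A {x}"
  by (auto simp: linked_def subset_singleton_iff)

lemma linked_mono: "A \<subseteq> A' \<Longrightarrow> linked A B \<Longrightarrow> linked A' B"
  unfolding linked_def by blast

lemma linked_pair: "sym A \<Longrightarrow> (u, v) \<in> A \<Longrightarrow> linked A {u, v}"
  by (intro linkedI) (auto dest: symD)

lemma minor_model_mono:
  assumes "A \<subseteq> A'" "minor_model n R A B"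
  shows "minor_model n R A' B"
proof -
  have "A \<inter> B i \<times> B j \<noteq> {} \<Longrightarrow> A' \<inter> B i \<times> B j \<noteq> {}" for i j
    using assms(1) by blast
  then show ?thesis
    using assms linked_mono[OF assms(1)] unfolding minor_model_def by simp
qed

lemma K5_minor_mono: "A \<subseteq> A' \<Longrightarrow> K5_minor A \<Longrightarrow> K5_minor A'"
  unfolding K5_minor_def using minor_model_mono by blast

lemma K5_minorI:
  fixes B :: "nat \<Rightarrow> 'a set"
  assumes "sym A" and "\<And>i. i < 5 \<Longrightarrow> B i \<noteq> {}" "\<And>i. i < 5 \<Longrightarrow> linked A (B i)"
    and "\<And>i j. i < j \<Longrightarrow> j < 5 \<Longrightarrow> B i \<inter> B j = {}"
    and "\<And>i j. i < j \<Longrightarrow> j < 5 \<Longrightarrow> A \<inter> B i \<times> B j \<noteq> {}"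
  shows "K5_minor A"
proof -
  have "B i \<inter> B j = {} \<and> A \<inter> B i \<times> B j \<noteq> {}" if "i < 5" "j < 5" "i \<noteq> j" for i j
  proof (cases "i < j")
    case True
    then show ?thesis using assms that by auto
  next
    case False
    then have "B j \<inter> B i = {}" "A \<inter> B j \<times> B i \<noteq> {}" using assms that by auto
    then show ?thesis using symD[OF assms(1)] by blast
  qed
  then show ?thesis
    unfolding K5_minor_def minor_model_def using assms(2,3) by blast
qed

lemma K33_minorI:
  fixes X Y :: "nat \<Rightarrow> 'a set"
  assumes A: "sym A"
    and ne: "\<And>s. s < 3 \<Longrightarrow> X s \<noteq> {}" "\<And>s. s < 3 \<Longrightarrow> Y s \<noteq> {}"
    and linked: "\<And>s. s < 3 \<Longrightarrow> linked A (X s)" "\<And>s. s < 3 \<Longrightarrow> linked A (Y s)"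
    and disj: "\<And>s t. s < 3 \<Longrightarrow> t < 3 \<Longrightarrow> X s \<inter> Y t = {}"
      "\<And>s t. s < t \<Longrightarrow> t < 3 \<Longrightarrow> X s \<inter> X t = {}" "\<And>s t. s < t \<Longrightarrow> t < 3 \<Longrightarrow> Y s \<inter> Y t = {}"
    and adj: "\<And>s t. s < 3 \<Longrightarrow> t < 3 \<Longrightarrow> A \<inter> X s \<times> Y t \<noteq> {}"
  shows "K33_minor A"
proof -
  define B where "B i = (if even i then X (i div 2) else Y (i div 2))" for i
  have d: "X s \<inter> X t = {}" "Y s \<inter> Y t = {}" if "s < 3" "t < 3" "s \<noteq> t" for s t
    using that disj(2,3)[of s t] disj(2,3)[of t s] by (cases "s < t"; force)+
  have adj': "A \<inter> Y t \<times> X s \<noteq> {}" if "s < 3" "t < 3" for s t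
    using adj[OF that] symD[OF A] by blast
  have h: "i div 2 < 3" if "i < 6" for i :: nat
    using that by auto
  have ne2: "i div 2 \<noteq> j div 2" if "even i = even j" "i \<noteq> j" for i j :: nat
    using that by (metis dvd_mult_div_cancel odd_two_times_div_two_succ)
  have "minor_model 6 (\<lambda>i j. odd (i + j)) A B"
    unfolding minor_model_def
  proof (intro conjI allI impI)
    fix i :: nat assume "i < 6"
    then show "B i \<noteq> {}" "linked A (B i)"
      using ne linked h[of i] unfolding B_def by auto
  next
    fix i j :: nat assume ij: "i < 6" "j < 6" "i \<noteq> j"
    then show "B i \<inter> B j = {}"
      using d[of "i div 2" "j div 2"] disj(1)[of "i div 2" "j div 2"] disj(1)[of "j div 2" "i div 2"]
        h[of i] h[of j] ne2[of i j]
      unfolding B_def by (cases "even i"; cases "even j") auto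
  next
    fix i j :: nat assume ij: "i < 6" "j < 6" "i \<noteq> j \<and> odd (i + j)"
    then show "A \<inter> B i \<times> B j \<noteq> {}"
      using adj[of "i div 2" "j div 2"] adj'[of "j div 2" "i div 2"] h[of i] h[of j]
      unfolding B_def by (cases "even i"; cases "even j") auto
  qed
  then show ?thesis unfolding K33_minor_def by blast
qed

section \<open>Contracting an edge\<close>

definition contract :: "('a \<times> 'a) set \<Rightarrow> 'a \<Rightarrow> 'a \<Rightarrow> ('a \<times> 'a) set" where
  "contract A u v = map_prod (id(v := u)) (id(v := u)) ` A - Id"

text \<open>A cut of the preimage either splits a fibre, and the fibre supplies a crossing arc, or
  it is a union of fibres, and then its image is a cut of \<open>B\<close>.\<close>

lemma linked_vimage:
  assumes fib: "\<And>x. linked A (f -` {x})" and B: "linked (map_prod f f ` A - Id) B"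
  shows "linked A (f -` B)"
proof (rule linkedI)
  fix S assume S: "S \<subseteq> f -` B" "S \<noteq> {}" "S \<noteq> f -` B"
  show "\<exists>a b. (a, b) \<in> A \<and> a \<in> S \<and> b \<in> f -` B \<and> b \<notin> S"
  proof (cases "\<exists>x. S \<inter> f -` {x} \<noteq> {} \<and> S \<inter> f -` {x} \<noteq> f -` {x}")
    case True
    then obtain x where x: "S \<inter> f -` {x} \<noteq> {}" "S \<inter> f -` {x} \<noteq> f -` {x}" by blast
    obtain a b where ab: "(a, b) \<in> A" "a \<in> S \<inter> f -` {x}" "b \<in> f -` {x}" "b \<notin> S \<inter> f -` {x}"
      by (rule linkedE[OF fib[of x] Int_lower2 x])
    then have "f b = f a" "f a \<in> B" using S(1) by auto
    then have "b \<in> f -` B" by simp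
    then show ?thesis using ab by blast
  next
    case False
    then have sat: "b \<in> S" if "a \<in> S" "f a = f b" for a b
      using that by blast
    have "f ` S \<noteq> B"
    proof
      assume "f ` S = B"
      then have "f -` B \<subseteq> S" using sat by (metis imageE subsetI vimageE)
      then show False using S by blast
    qed
    moreover have "f ` S \<subseteq> B" "f ` S \<noteq> {}" using S by auto
    ultimately obtain x y where xy: "(x, y) \<in> map_prod f f ` A - Id" "x \<in> f ` S" "y \<in> B" "y \<notin> f ` S"
      using linkedE[OF B] by metis
    then obtain a b where ab: "(a, b) \<in> A" "x = f a" "y = f b" by auto
    then have "a \<in> S" "b \<notin> S" using xy sat by auto
    moreover have "b \<in> f -` B" using ab(3) xy(3) by simp
    ultimately show ?thesis using ab(1) by blast
  qed
qed

text \<open>As \<open>f\<close> need not be surjective, a preimage could be empty; an arc to some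
  required neighbour, guaranteed by the condition on \<open>R\<close>, shows that it is not.\<close>

lemma minor_model_vimage:
  assumes fib: "\<And>x. linked A (f -` {x})" and m: "minor_model n R (map_prod f f ` A - Id) B"
    and R: "\<And>i. i < n \<Longrightarrow> \<exists>j<n. j \<noteq> i \<and> R i j"
  shows "minor_model n R A (\<lambda>i. f -` B i)"
  unfolding minor_model_def
proof (intro conjI allI impI)
  fix i j assume "i < n" "j < n" "i \<noteq> j"
  then show "f -` B i \<inter> f -` B j = {}"
    using m unfolding minor_model_def by blast
next
  have adj: "A \<inter> f -` B i \<times> f -` B j \<noteq> {}" if "i < n" "j < n" "i \<noteq> j \<and> R i j" for i j
  proof -
    have "(map_prod f f ` A - Id) \<inter> B i \<times> B j \<noteq> {}"
      using m that unfolding minor_model_def by blast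
    then show ?thesis by fastforce
  qed
  then show "A \<inter> f -` B i \<times> f -` B j \<noteq> {}" if "i < n" "j < n" "i \<noteq> j \<and> R i j" for i j
    using that by blast
  fix i assume i: "i < n"
  then obtain j where "j < n" "j \<noteq> i" "R i j" using R by blast
  then show "f -` B i \<noteq> {}" using adj[of i j] i by blast
  show "linked A (f -` B i)"
    using m i unfolding minor_model_def by (intro linked_vimage[OF fib]) blast
qed

lemma K5_minor_contract:
  assumes "sym A" "(u, v) \<in> A" "K5_minor (contract A u v)"
  shows "K5_minor A"
proof -
  let ?f = "id(v := u)"
  have "linked A (?f -` {x})" for x
  proof -
    have "?f -` {x} = (if x = u then {u, v} else if x = v then {} else {x})"
      by (auto split: if_splits)
    then show ?thesis using linked_pair[OF assms(1,2)] by auto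
  qed
  moreover have "\<exists>j<5. j \<noteq> i \<and> True" for i :: nat
    by (rule exI[of _ "if i = 0 then 1 else 0"]) auto
  moreover obtain B where "minor_model 5 (\<lambda>_ _. True) (map_prod ?f ?f ` A - Id) B"
    using assms(3) unfolding K5_minor_def contract_def by blast
  ultimately show ?thesis
    unfolding K5_minor_def using minor_model_vimage[of A ?f 5 "\<lambda>_ _. True" B] by blast
qed

section \<open>Replacing a star with at most three leaves by a clique\<close>

definition star_to_clique :: "('a \<times> 'a) set \<Rightarrow> 'a \<Rightarrow> ('a \<times> 'a) set" where
  "star_to_clique A y = {(a, b) \<in> A. a \<noteq> y \<and> b \<noteq> y} \<union> {(a, b). a \<noteq> b \<and> (y, a) \<in> A \<and> (y, b) \<in> A}"

context
  fixes A :: "('a \<times> 'a) set" and y :: 'a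
  assumes symA: "sym A" and yy: "(y, y) \<notin> A"
    and deg3: "finite (A `` {y})" "card (A `` {y}) \<le> 3"
begin

lemma star_to_cliqueD: "(a, b) \<in> star_to_clique A y \<Longrightarrow> (a, b) \<in> A \<or> a \<noteq> b \<and> (y, a) \<in> A \<and> (y, b) \<in> A"
  by (auto simp: star_to_clique_def)

lemma not_four: "a \<in> A `` {y} \<Longrightarrow> b \<in> A `` {y} \<Longrightarrow> c \<in> A `` {y} \<Longrightarrow> d \<in> A `` {y} \<Longrightarrow>
    a \<noteq> b \<Longrightarrow> a \<noteq> c \<Longrightarrow> a \<noteq> d \<Longrightarrow> b \<noteq> c \<Longrightarrow> b \<noteq> d \<Longrightarrow> c \<noteq> d \<Longrightarrow> False"
proof -
  assume h: "a \<in> A `` {y}" "b \<in> A `` {y}" "c \<in> A `` {y}" "d \<in> A `` {y}"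
    "a \<noteq> b" "a \<noteq> c" "a \<noteq> d" "b \<noteq> c" "b \<noteq> d" "c \<noteq> d"
  then have "card {a, b, c, d} \<le> card (A `` {y})"
    by (intro card_mono deg3) auto
  then show False using h deg3 by simp
qed

text \<open>Each clique edge stands for a path through \<open>y\<close>, so adding \<open>y\<close>
  restores connectedness; \<open>c\<close> attaches \<open>y\<close> itself.\<close>

lemma linked_star_insert:
  assumes B: "linked (star_to_clique A y) B" and c: "c \<in> B" "(y, c) \<in> A"
  shows "linked A (insert y B)"
proof (rule linkedI)
  fix S assume S: "S \<subseteq> insert y B" "S \<noteq> {}" "S \<noteq> insert y B"
  have c': "(c, y) \<in> A" using c symA by (auto dest: symD)
  show "\<exists>a b. (a, b) \<in> A \<and> a \<in> S \<and> b \<in> insert y B \<and> b \<notin> S"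
  proof (cases "y \<in> S \<longleftrightarrow> c \<in> S")
    case False
    then show ?thesis using c c' by blast
  next
    case True
    let ?S = "S \<inter> B"
    have "?S \<noteq> {}" "?S \<noteq> B"
      using S True c by blast+
    then obtain a b where ab: "(a, b) \<in> star_to_clique A y" "a \<in> ?S" "b \<in> B" "b \<notin> ?S"
      using linkedE[OF B] by (metis Int_lower2)
    show ?thesis
    proof (cases "(a, b) \<in> A")
      case True
      then show ?thesis using ab by blast
    next
      case False
      then have "(a, y) \<in> A" "(y, b) \<in> A"
        using star_to_cliqueD[OF ab(1)] symA by (auto dest: symD)
      then show ?thesis using ab by (cases "y \<in> S") blast+
    qed
  qed
qed

text \<open>A clique edge inside \<open>B\<close> would need two neighbours of \<open>y\<close>
  there.\<close>

lemma linked_star_avoid: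
  assumes B: "linked (star_to_clique A y) B"
    and one: "\<And>a b. a \<in> B \<Longrightarrow> b \<in> B \<Longrightarrow> (y, a) \<in> A \<Longrightarrow> (y, b) \<in> A \<Longrightarrow> a = b"
  shows "linked A B"
proof (rule linkedI)
  fix S assume S: "S \<subseteq> B" "S \<noteq> {}" "S \<noteq> B"
  obtain a b where ab: "(a, b) \<in> star_to_clique A y" "a \<in> S" "b \<in> B" "b \<notin> S"
    by (rule linkedE[OF B S])
  then show "\<exists>a b. (a, b) \<in> A \<and> a \<in> S \<and> b \<in> B \<and> b \<notin> S"
    using star_to_cliqueD[OF ab(1)] one[of a b] S by blast
qed

text \<open>After the replacement \<open>y\<close> is isolated, but a branch set with a required
  neighbour contains no isolated vertex.\<close>

lemma star_not_in_model:
  assumes m: "minor_model n R (star_to_clique A y) B" and i: "i < n" "j < n" "i \<noteq> j" "R i j"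
  shows "y \<notin> B i"
proof
  assume yB: "y \<in> B i"
  have no: "(y, b) \<notin> star_to_clique A y" for b
    using yy by (auto simp: star_to_clique_def)
  have "star_to_clique A y \<inter> B i \<times> B j \<noteq> {}" and l: "linked (star_to_clique A y) (B i)"
    using m i unfolding minor_model_def by blast+
  then have "B i \<noteq> {y}" using no by auto
  moreover have "{y} \<subseteq> B i" using yB by simp
  ultimately obtain a b where "(a, b) \<in> star_to_clique A y" "a \<in> {y}"
    using linkedE[OF l, of "{y}"] by (metis insert_not_empty)
  then show False using no by auto
qed

text \<open>With \<open>y\<close> in branch set \<open>i\<close>, a clique edge at this set is
  replaced by an arc at \<open>y\<close>. The assumptions \<open>one\<close> and \<open>two\<close>
  say that no clique edge is used within or between the other branch sets.\<close>

lemma star_model_center: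
  assumes m: "minor_model n R (star_to_clique A y) B"
    and yB: "\<And>j. j < n \<Longrightarrow> y \<notin> B j"
    and i: "i < n" and c: "c \<in> B i" "(y, c) \<in> A"
    and one: "\<And>j a b. j < n \<Longrightarrow> j \<noteq> i \<Longrightarrow> a \<in> B j \<Longrightarrow> b \<in> B j \<Longrightarrow> (y, a) \<in> A \<Longrightarrow> (y, b) \<in> A \<Longrightarrow> a = b"
    and two: "\<And>j k a b. j < n \<Longrightarrow> k < n \<Longrightarrow> j \<noteq> i \<Longrightarrow> k \<noteq> i \<Longrightarrow> j \<noteq> k \<Longrightarrow> R j k \<Longrightarrow>
      a \<in> B j \<Longrightarrow> b \<in> B k \<Longrightarrow> (y, a) \<in> A \<Longrightarrow> (y, b) \<in> A \<Longrightarrow> False"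
  shows "minor_model n R A (B(i := insert y (B i)))"
proof -
  have lB: "B j \<noteq> {}" "linked (star_to_clique A y) (B j)" if "j < n" for j
    using m that unfolding minor_model_def by blast+
  have "linked A (insert y (B i))"
    using linked_star_insert[OF lB(2)[OF i] c] .
  moreover have "linked A (B j)" if "j < n" "j \<noteq> i" for j
    using linked_star_avoid[OF lB(2)[OF that(1)]] one[OF that] by blast
  moreover have "A \<inter> (B(i := insert y (B i))) j \<times> (B(i := insert y (B i))) k \<noteq> {}"
    if jk: "j < n" "k < n" "j \<noteq> k" "R j k" for j k
  proof -
    obtain a b where ab: "(a, b) \<in> star_to_clique A y" "a \<in> B j" "b \<in> B k"
      using m jk unfolding minor_model_def by blast
    show ?thesis
    proof (cases "(a, b) \<in> A")
      case True
      then show ?thesis using ab by auto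
    next
      case False
      then have ya: "(y, a) \<in> A" "(y, b) \<in> A" "(a, y) \<in> A"
        using star_to_cliqueD[OF ab(1)] symA by (auto dest: symD)
      then have "j = i \<or> k = i" using two[OF jk(1,2) _ _ jk(3,4) ab(2,3)] by blast
      then show ?thesis using ya ab jk(3) by auto
    qed
  qed
  moreover have "(B(i := insert y (B i))) j \<inter> (B(i := insert y (B i))) k = {}"
    if jk: "j < n" "k < n" "j \<noteq> k" for j k
  proof -
    have "B j \<inter> B k = {}" using m jk unfolding minor_model_def by blast
    then show ?thesis using yB jk by auto
  qed
  ultimately show ?thesis
    unfolding minor_model_def using lB(1) by (simp split: if_splits)
qed

text \<open>If no branch set can absorb \<open>y\<close>, then \<open>y\<close> has one neighbour in each of three pairwise
  adjacent branch sets.\<close>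

lemma star_model_cases:
  assumes m: "minor_model n R (star_to_clique A y) B" and R: "\<And>i. i < n \<Longrightarrow> \<exists>j<n. i \<noteq> j \<and> R i j"
    and no: "\<And>B'. \<not> minor_model n R A B'"
  obtains i j k a b c where "i < n" "j < n" "k < n" "i \<noteq> j" "i \<noteq> k" "j \<noteq> k"
    "a \<in> B i" "b \<in> B j" "c \<in> B k" "(y, a) \<in> A" "(y, b) \<in> A" "(y, c) \<in> A"
    "R i j \<or> R j i" "R i k \<or> R k i" "R j k \<or> R k j"
proof -
  have yB: "y \<notin> B j" if "j < n" for j
    using star_not_in_model[OF m that] R[OF that] by blast
  have disj: "i = j" if "a \<in> B i" "a \<in> B j" "i < n" "j < n" for a i j
    using m that unfolding minor_model_def by blast
  have ex: "\<exists>i<n. \<exists>c\<in>B i. (y, c) \<in> A"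
  proof (rule ccontr)
    assume none: "\<not> ?thesis"
    have "A \<inter> B i \<times> B j \<noteq> {}" if ij: "i < n" "j < n" "i \<noteq> j" "R i j" for i j
    proof -
      obtain a b where "(a, b) \<in> star_to_clique A y" "a \<in> B i" "b \<in> B j"
        using m ij unfolding minor_model_def by blast
      then show ?thesis using star_to_cliqueD[of a b] none ij by blast
    qed
    moreover have "linked A (B i)" if "i < n" for i
      using m that none unfolding minor_model_def by (intro linked_star_avoid) blast+
    ultimately have "minor_model n R A B"
      using m unfolding minor_model_def by blast
    then show False using no by blast
  qed
  \<comment> \<open>Two leaves in one branch set leave at most one elsewhere, so this set could
    absorb \<open>y\<close>.\<close>
  have one: "a = b" if ab: "i < n" "a \<in> B i" "b \<in> B i" "(y, a) \<in> A" "(y, b) \<in> A" for i a b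
  proof (rule ccontr)
    assume ne: "a \<noteq> b"
    have "minor_model n R A (B(i := insert y (B i)))"
    proof (rule star_model_center[OF m yB ab(1,2,4)])
      fix j a' b' assume h: "j < n" "j \<noteq> i" "a' \<in> B j" "b' \<in> B j" "(y, a') \<in> A" "(y, b') \<in> A"
      then have "a \<noteq> a'" "a \<noteq> b'" "b \<noteq> a'" "b \<noteq> b'" using disj ab by blast+
      then show "a' = b'" using not_four[of a b a' b'] ne ab h by auto
    next
      fix j k a' b' assume h: "j < n" "k < n" "j \<noteq> i" "k \<noteq> i" "j \<noteq> k" "a' \<in> B j" "b' \<in> B k" "(y, a') \<in> A" "(y, b') \<in> A"
      then have "a \<noteq> a'" "a \<noteq> b'" "b \<noteq> a'" "b \<noteq> b'" "a' \<noteq> b'" using disj ab by blast+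
      then show False using not_four[of a b a' b'] ne ab h by auto
    qed
    then show False using no by blast
  qed
  \<comment> \<open>What still prevents the set of \<open>c\<close> from absorbing \<open>y\<close>
    is a clique edge joining two other branch sets.\<close>
  have cen: "\<exists>j k a b. j < n \<and> k < n \<and> j \<noteq> i \<and> k \<noteq> i \<and> j \<noteq> k \<and> R j k \<and> a \<in> B j \<and> b \<in> B k \<and> (y, a) \<in> A \<and> (y, b) \<in> A"
    if c: "i < n" "c \<in> B i" "(y, c) \<in> A" for i c
  proof (rule ccontr)
    assume none: "\<not> ?thesis"
    have "minor_model n R A (B(i := insert y (B i)))"
      by (rule star_model_center[OF m yB c]) (use one none in blast)+
    then show False using no by blast
  qed
  obtain i a where i: "i < n" "a \<in> B i" "(y, a) \<in> A" using ex by blast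
  obtain j k b c where jk: "j < n" "k < n" "j \<noteq> i" "k \<noteq> i" "j \<noteq> k" "R j k" "b \<in> B j" "c \<in> B k" "(y, b) \<in> A" "(y, c) \<in> A"
    using cen[OF i] by blast
  have abc: "a \<noteq> b" "a \<noteq> c" "b \<noteq> c" using disj i jk by blast+
  have three: "l \<in> {i, j, k}" if "l < n" "d \<in> B l" "(y, d) \<in> A" for l d
  proof (rule ccontr)
    assume "l \<notin> {i, j, k}"
    then have "d \<noteq> a" "d \<noteq> b" "d \<noteq> c" using disj i jk that by blast+
    then show False using not_four[of a b c d] abc i jk that by auto
  qed
  \<comment> \<open>All leaves lie in the sets \<open>i\<close>, \<open>j\<close>, \<open>k\<close>,
    so the pair that \<open>cen\<close> returns for \<open>j\<close> can only be \<open>i\<close>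
    and \<open>k\<close>.\<close>
  have "R i k \<or> R k i"
    using cen[OF jk(1,7,9)] three i(1) jk(3,4,5) by (metis insertE singletonD)
  moreover have "R i j \<or> R j i"
    using cen[OF jk(2,8,10)] three i(1) jk(3,4,5) by (metis insertE singletonD)
  ultimately show thesis
    using that[OF i(1) jk(1,2) _ _ _ i(2) jk(7,8) i(3) jk(9,10)] jk by metis
qed

text \<open>The remaining case would be a triangle in a bipartite pattern.\<close>

lemma star_to_clique_K33_minor:
  assumes "K33_minor (star_to_clique A y)"
  shows "K33_minor A"
proof (rule ccontr)
  assume no: "\<not> K33_minor A"
  obtain B where m: "minor_model 6 (\<lambda>i j. odd (i + j)) (star_to_clique A y) B"
    using assms unfolding K33_minor_def by blast
  have R: "\<exists>j<6. i \<noteq> j \<and> odd (i + j)" for i :: nat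
    by (rule exI[of _ "if odd i then 0 else 1"]) (auto elim: oddE)
  have no': "\<not> minor_model 6 (\<lambda>i j. odd (i + j)) A B'" for B'
    using no unfolding K33_minor_def by blast
  obtain i j k :: nat where "odd (i + j) \<or> odd (j + i)" "odd (i + k) \<or> odd (k + i)" "odd (j + k) \<or> odd (k + j)"
    by (rule star_model_cases[OF m R no'])
  then show False by (auto simp: even_add)
qed

text \<open>In the remaining case the three branch sets containing leaves form one side of a
  \<open>K33\<close> model; the other two branch sets and the singleton of \<open>y\<close> form the
  other side.\<close>

lemma star_to_clique_K5_minor:
  assumes "K5_minor (star_to_clique A y)"
  shows "K5_minor A \<or> K33_minor A"
proof (rule ccontr)
  assume no: "\<not> (K5_minor A \<or> K33_minor A)"
  obtain B where m: "minor_model 5 (\<lambda>_ _. True) (star_to_clique A y) B"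
    using assms unfolding K5_minor_def by blast
  have R: "\<exists>j<5. i \<noteq> j \<and> True" for i :: nat
    by (rule exI[of _ "if i = 0 then 1 else 0"]) auto
  have no': "\<not> minor_model 5 (\<lambda>_ _. True) A B'" for B'
    using no unfolding K5_minor_def by blast
  obtain i j k a b c where h: "i < 5" "j < 5" "k < (5::nat)" "i \<noteq> j" "i \<noteq> k" "j \<noteq> k"
    "a \<in> B i" "b \<in> B j" "c \<in> B k" "(y, a) \<in> A" "(y, b) \<in> A" "(y, c) \<in> A"
    by (rule star_model_cases[OF m R no'])
  have "card ({..<5} - {i, j, k}) = 2"
    using h by (subst card_Diff_subset) auto
  then obtain l m' where lm: "{..<5} - {i, j, k} = {l, m'}" "l \<noteq> m'"
    by (auto simp: card_2_iff)
  then have lm': "l < 5" "m' < 5" "l \<notin> {i, j, k}" "m' \<notin> {i, j, k}" by auto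
  have yB: "y \<notin> B j" if "j < 5" for j
    using star_not_in_model[OF m that] R[of j] by blast
  have disj: "B s \<inter> B t = {}" if "s < 5" "t < 5" "s \<noteq> t" for s t
    using m that unfolding minor_model_def by blast
  have abc: "a \<noteq> b" "a \<noteq> c" "b \<noteq> c" using disj h by blast+
  have only: "s = i \<and> d = a \<or> s = j \<and> d = b \<or> s = k \<and> d = c" if "d \<in> B s" "s < 5" "(y, d) \<in> A" for d s
  proof -
    have "d = a \<or> d = b \<or> d = c"
      using not_four[of a b c d] abc h that by auto
    then show ?thesis using disj[of s] that h by blast
  qed
  \<comment> \<open>No leaf lies in \<open>B l\<close> or \<open>B m'\<close>, so arcs into these
    sets are not clique edges.\<close>
  have adj: "A \<inter> B s \<times> B t \<noteq> {}" if st: "s < 5" "t \<in> {l, m'}" "s \<noteq> t" for s t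
  proof -
    have t: "t < 5" using st lm' by auto
    then obtain p q where "(p, q) \<in> star_to_clique A y" "p \<in> B s" "q \<in> B t"
      using m st unfolding minor_model_def by blast
    moreover have "(y, q) \<notin> A" using only[OF \<open>q \<in> B t\<close> t] st(2) lm' by auto
    ultimately show ?thesis using star_to_cliqueD by blast
  qed
  have linked: "linked A (B s)" if s: "s < 5" for s
  proof (rule linked_star_avoid)
    show "linked (star_to_clique A y) (B s)"
      using m s unfolding minor_model_def by blast
    show "p = q" if "p \<in> B s" "q \<in> B s" "(y, p) \<in> A" "(y, q) \<in> A" for p q
      using only[of p s] only[of q s] s that h(4-6) by auto
  qed
  have ne: "B s \<noteq> {}" if "s < 5" for s
    using m that unfolding minor_model_def by blast
  define X where "X = (!) [B i, B j, B k]"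
  define Y where "Y = (!) [B l, B m', {y}]"
  have X: "X 0 = B i" "X (Suc 0) = B j" "X 2 = B k" and Y: "Y 0 = B l" "Y (Suc 0) = B m'" "Y 2 = {y}"
    by (auto simp: X_def Y_def)
  have less3: "s = 0 \<or> s = Suc 0 \<or> s = 2" if "s < 3" for s :: nat
    using that by auto
  have less3': "s = 0 \<and> t = Suc 0 \<or> s = 0 \<and> t = 2 \<or> s = Suc 0 \<and> t = 2" if "s < t" "t < 3" for s t :: nat
    using that by auto
  have "K33_minor A"
  proof (rule K33_minorI[OF symA, of X Y])
    fix s t :: nat assume st: "s < 3" "t < 3"
    have s: "\<exists>p\<in>{i, j, k}. X s = B p" and t: "Y t = {y} \<or> (\<exists>q\<in>{l, m'}. Y t = B q)"
      using less3[OF st(1)] less3[OF st(2)] by (auto simp: X Y)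
    then obtain p where p: "p \<in> {i, j, k}" "X s = B p" by blast
    have "A \<inter> B p \<times> {y} \<noteq> {}"
      using p(1) h symD[OF symA] by blast
    moreover have "A \<inter> B p \<times> B q \<noteq> {}" if "q \<in> {l, m'}" for q
      using adj[of p q] p(1) h that lm' by blast
    ultimately show "A \<inter> X s \<times> Y t \<noteq> {}"
      using t p(2) by metis
    have "B p \<inter> {y} = {}"
      using p(1) h yB by auto
    moreover have "B p \<inter> B q = {}" if "q \<in> {l, m'}" for q
      using disj[of p q] p(1) h that lm' by blast
    ultimately show "X s \<inter> Y t = {}"
      using t p(2) by metis
  next
    fix s :: nat assume s: "s < 3"
    show "X s \<noteq> {}" "Y s \<noteq> {}" "linked A (X s)" "linked A (Y s)"
      using less3[OF s] ne linked h lm' by (auto simp: X Y)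
  next
    fix s t :: nat assume st: "s < t" "t < 3"
    show "X s \<inter> X t = {}" "Y s \<inter> Y t = {}"
      using less3'[OF st] disj[OF h(1,2,4)] disj[OF h(1,3,5)] disj[OF h(2,3,6)]
        disj[OF lm'(1,2) lm(2)] yB[OF lm'(1)] yB[OF lm'(2)]
      by (elim disjE; simp add: X Y)+
  qed
  then show False using no by blast
qed

end

section \<open>Edge bounds\<close>

lemma card_as_degree_sum:
  assumes "finite V" "finite W" "A \<subseteq> V \<times> W"
  shows "card A = (\<Sum>v\<in>V. card (A `` {v}))"
proof -
  have "A = Sigma V (\<lambda>v. A `` {v})" using assms by auto
  moreover have "finite (A `` {v})" for v
    using assms by (meson finite_SigmaI finite_Image finite_subset)
  ultimately show ?thesis
    using card_SigmaI[OF assms(1), of "\<lambda>v. A `` {v}"] by metis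
qed

lemma contract_iff:
  "(a, b) \<in> contract A u v \<longleftrightarrow> a \<noteq> b \<and> (\<exists>c d. (c, d) \<in> A \<and> a = (id(v := u)) c \<and> b = (id(v := u)) d)"
  unfolding contract_def by (auto simp: image_iff Bex_def simp del: fun_upd_apply)

lemma irrefl_contract: "irrefl (contract A u v)"
  by (simp add: irrefl_def contract_iff)

lemma sym_contract: "sym A \<Longrightarrow> sym (contract A u v)"
  by (rule symI) (metis contract_iff symD)

text \<open>\<open>E\<close> collects what a contraction can lose: the two arcs of the edge, which
  become loops, and for each common neighbour the two arcs at \<open>v\<close>, which coincide with
  those at \<open>u\<close>. Off \<open>E\<close> the contraction is injective on arcs.\<close>

lemma card_contract:
  assumes A: "finite A" "sym A" "irrefl A" and uv: "(u, v) \<in> A"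
  shows "card A \<le> card (contract A u v) + 2 + 2 * card (A `` {u} \<inter> A `` {v})"
proof -
  let ?f = "id(v := u)" and ?N = "A `` {u} \<inter> A `` {v}"
  define E where "E = {(u, v), (v, u)} \<union> {v} \<times> ?N \<union> ?N \<times> {v}"
  have sym: "(b, a) \<in> A" if "(a, b) \<in> A" for a b
    using that A(2) by (rule symD[rotated])
  have irr: "(a, a) \<notin> A" for a
    using A(3) by (simp add: irrefl_def)
  have fN: "finite ?N"
    using A(1) by (simp add: finite_Image)
  have "card E \<le> card ({(u, v), (v, u)} \<union> {v} \<times> ?N) + card (?N \<times> {v})"
    unfolding E_def by (rule card_Un_le)
  moreover have "card ({(u, v), (v, u)} \<union> {v} \<times> ?N) \<le> card {(u, v), (v, u)} + card ({v} \<times> ?N)"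
    by (rule card_Un_le)
  moreover have "card {(u, v), (v, u)} \<le> 2"
    by (rule card_insert_le_m1) simp_all
  moreover have "card ({v} \<times> ?N) = card ?N" "card (?N \<times> {v}) = card ?N"
    using card_cartesian_product[of "{v}" ?N] card_cartesian_product[of ?N "{v}"] by simp_all
  ultimately have "card E \<le> 2 + 2 * card ?N"
    by linarith
  moreover have "finite E"
    unfolding E_def using fN by simp
  then have "card A \<le> card (A - E) + card E"
    using A(1) by (metis card_Diff_subset_Int card_mono diff_card_le_card_Diff le_diff_conv)
  moreover have "card (A - E) \<le> card (contract A u v)"
  proof (rule card_inj_on_le)
    show "finite (contract A u v)"
      unfolding contract_def using A(1) by simp
    show "map_prod ?f ?f ` (A - E) \<subseteq> contract A u v"
      unfolding contract_def E_def using irr by (auto split: if_splits)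
    show "inj_on (map_prod ?f ?f) (A - E)"
    proof (rule inj_onI, clarify)
      fix a b c d assume h: "(a, b) \<in> A" "(c, d) \<in> A" "(a, b) \<notin> E" "(c, d) \<notin> E"
        "map_prod ?f ?f (a, b) = map_prod ?f ?f (c, d)"
      then have f: "?f a = ?f c" "?f b = ?f d" by auto
      have x: "x = y \<or> x = u \<and> y = v \<or> x = v \<and> y = u" if "?f x = ?f y" for x y
        using that by (auto split: if_splits)
      have e: "a' \<noteq> v" if "(a', b') \<in> A" "(a', b') \<notin> E" "(u, b') \<in> A" for a' b'
        using that sym unfolding E_def by auto
      have e': "b' \<noteq> v" if "(a', b') \<in> A" "(a', b') \<notin> E" "(a', u) \<in> A" for a' b'
        using that sym unfolding E_def by auto
      have "\<not> (a \<in> {u, v} \<and> b \<in> {u, v})"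
        using h(1,3) irr unfolding E_def by auto
      then show "a = c \<and> b = d"
        using x[OF f(1)] x[OF f(2)] e[of a b] e[of c d] e'[of a b] e'[of c d] h by auto
    qed
  qed
  ultimately show ?thesis by linarith
qed

lemma K5_minor_of_list:
  assumes "sym A" and "a \<noteq> {}" "b \<noteq> {}" "c \<noteq> {}" "d \<noteq> {}" "e \<noteq> {}"
    and "linked A a" "linked A b" "linked A c" "linked A d" "linked A e"
    and "a \<inter> b = {}" "a \<inter> c = {}" "a \<inter> d = {}" "a \<inter> e = {}" "b \<inter> c = {}" "b \<inter> d = {}" "b \<inter> e = {}"
      "c \<inter> d = {}" "c \<inter> e = {}" "d \<inter> e = {}"
    and "A \<inter> a \<times> b \<noteq> {}" "A \<inter> a \<times> c \<noteq> {}" "A \<inter> a \<times> d \<noteq> {}" "A \<inter> a \<times> e \<noteq> {}"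
      "A \<inter> b \<times> c \<noteq> {}" "A \<inter> b \<times> d \<noteq> {}" "A \<inter> b \<times> e \<noteq> {}"
      "A \<inter> c \<times> d \<noteq> {}" "A \<inter> c \<times> e \<noteq> {}" "A \<inter> d \<times> e \<noteq> {}"
  shows "K5_minor A"
proof (rule K5_minorI[OF assms(1), of "(!) [a, b, c, d, e]"])
  have c: "i \<in> {0, 1, 2, 3, 4}" if "i < 5" for i :: nat
    using that by auto
  show "[a, b, c, d, e] ! i \<noteq> {}" "linked A ([a, b, c, d, e] ! i)" if "i < 5" for i
    using c[OF that] assms(2-11) by auto
  have c2: "(i, j) \<in> {(0,1), (0,2), (0,3), (0,4), (1,2), (1,3), (1,4), (2,3), (2,4), (3,4)}"
    if "i < j" "j < 5" for i j :: nat
    using c[OF that(2)] that(1) by (elim insertE) (simp_all add: less_Suc_eq numeral_eq_Suc)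
  show "[a, b, c, d, e] ! i \<inter> [a, b, c, d, e] ! j = {}" "A \<inter> [a, b, c, d, e] ! i \<times> [a, b, c, d, e] ! j \<noteq> {}"
    if "i < j" "j < 5" for i j
    using c2[OF that] assms(12-) by (elim insertE; simp)+
qed

text \<open>A graph on at most five vertices with minimum degree at least three contains a \<open>K4\<close> minor:
  if \<open>p\<close> and \<open>r\<close> are not adjacent, the other three vertices are adjacent to both and one of them,
  \<open>z\<close>, is adjacent to the other two, \<open>q\<close> and \<open>s\<close>; contract \<open>pq\<close>.\<close>

lemma K5_minor_of_nbhd:
  assumes A: "sym A" "irrefl A" and N: "finite (A `` {v})" "card (A `` {v}) \<le> 5" "A `` {v} \<noteq> {}"
    and deg: "\<And>w. w \<in> A `` {v} \<Longrightarrow> card (A `` {v} \<inter> A `` {w}) \<ge> 3"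
  shows "K5_minor A"
proof -
  let ?N = "A `` {v}"
  have sym: "(b, a) \<in> A" if "(a, b) \<in> A" for a b
    using that A(1) by (rule symD[rotated])
  have irr: "(a, a) \<notin> A" for a
    using A(2) by (simp add: irrefl_def)
  \<comment> \<open>As \<open>?N\<close> has at most five elements, each member misses at most two
    of them, itself included.\<close>
  have D: "card (?N - A `` {w}) + 3 \<le> card ?N" if "w \<in> ?N" for w
    using deg[OF that] N(1) card_Int_Diff[of ?N "A `` {w}"] by linarith
  show ?thesis
  proof (cases "\<forall>p\<in>?N. \<forall>q\<in>?N. p \<noteq> q \<longrightarrow> (p, q) \<in> A")
    case True
    obtain w where w: "w \<in> ?N" using N(3) by blast
    then have "w \<in> ?N - A `` {w}" using irr by blast
    then have "card (?N - A `` {w}) > 0" using N(1) by (metis card_gt_0_iff empty_iff finite_Diff)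
    then have "card ?N \<ge> 4" using D[OF w] by linarith
    then obtain M where M: "M \<subseteq> ?N" "card M = 4" by (meson obtain_subset_with_card_n)
    then obtain p q r s where "M = {p, q, r, s}" "p \<noteq> q" "p \<noteq> r" "p \<noteq> s" "q \<noteq> r" "q \<noteq> s" "r \<noteq> s"
      by (auto simp: numeral_eq_Suc card_Suc_eq)
    moreover from this have "p \<in> ?N" "q \<in> ?N" "r \<in> ?N" "s \<in> ?N" using M by auto
    moreover from this have "p \<noteq> v" "q \<noteq> v" "r \<noteq> v" "s \<noteq> v" using irr by auto
    ultimately show ?thesis
      using True by (intro K5_minor_of_list[OF A(1), of "{v}" "{p}" "{q}" "{r}" "{s}"]) auto
  next
    case False
    then obtain p r where pr: "p \<in> ?N" "r \<in> ?N" "p \<noteq> r" "(p, r) \<notin> A" "(r, p) \<notin> A"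
      using sym by blast
    have sub: "{p, r} \<subseteq> ?N - A `` {p}" "{p, r} \<subseteq> ?N - A `` {r}"
      using pr irr by auto
    have "card {p, r} = 2" using pr by simp
    then have "card ?N = 5" "card (?N - A `` {p}) \<le> 2" "card (?N - A `` {r}) \<le> 2"
      using D[OF pr(1)] D[OF pr(2)] N card_mono[OF _ sub(1)] by auto
    then have eq: "?N - A `` {p} = {p, r}" "?N - A `` {r} = {p, r}"
      using card_seteq[OF _ sub(1)] card_seteq[OF _ sub(2)] N(1) \<open>card {p, r} = 2\<close> by auto
    have "card (?N - {p, r}) = 3"
      using pr N(1) \<open>card ?N = 5\<close> by (subst card_Diff_subset) auto
    then obtain x y z where xyz: "?N - {p, r} = {x, y, z}" "x \<noteq> y" "x \<noteq> z" "y \<noteq> z"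
      by (auto simp: card_3_iff)
    then have inN: "x \<in> ?N" "y \<in> ?N" "z \<in> ?N" "x \<notin> {p, r}" "y \<notin> {p, r}" "z \<notin> {p, r}" by blast+
    have adj: "(p, w) \<in> A" "(r, w) \<in> A" if "w \<in> {x, y, z}" for w
      using eq that xyz(1) by blast+
    \<comment> \<open>Otherwise \<open>a\<close> would miss three members of \<open>?N\<close>,
      counting itself. So at most one pair among \<open>x\<close>, \<open>y\<close>,
      \<open>z\<close> is nonadjacent, and some vertex is adjacent to the other two.\<close>
    have no2: "\<not> ((a, b) \<notin> A \<and> (a, c) \<notin> A)" if "{a, b, c} = {x, y, z}" "a \<noteq> b" "a \<noteq> c" "b \<noteq> c" for a b c
    proof
      assume "(a, b) \<notin> A \<and> (a, c) \<notin> A"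
      then have "{a, b, c} \<inter> A `` {a} = {}" using irr by auto
      moreover have "{a, b, c} \<subseteq> ?N" unfolding that(1) using inN by blast
      ultimately have "{a, b, c} \<subseteq> ?N - A `` {a}" by blast
      then have "card {a, b, c} \<le> card (?N - A `` {a})" using N(1) by (intro card_mono) auto
      moreover have "card {a, b, c} = 3" using that(2-4) by simp
      moreover have "a \<in> ?N" using \<open>{a, b, c} \<subseteq> ?N\<close> by blast
      ultimately show False using D[of a] N(2) by linarith
    qed
    \<comment> \<open>The possible non-edges are \<open>p r\<close> and \<open>b c\<close>. Merging
      \<open>p\<close> with \<open>b\<close> repairs both: \<open>b\<close> is adjacent to
      \<open>r\<close>, and \<open>p\<close> to \<open>c\<close>.\<close>
    have fin: ?thesis if c: "{a, b, c} = {x, y, z}" "a \<noteq> b" "a \<noteq> c" "b \<noteq> c" "(a, b) \<in> A" "(a, c) \<in> A" for a b c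
    proof -
      have "a \<in> {x, y, z}" "b \<in> {x, y, z}" "c \<in> {x, y, z}" using c(1) by blast+
      then have "a \<in> ?N" "b \<in> ?N" "c \<in> ?N" "a \<notin> {p, r}" "b \<notin> {p, r}" "c \<notin> {p, r}"
        "(p, a) \<in> A" "(r, a) \<in> A" "(p, b) \<in> A" "(r, b) \<in> A" "(p, c) \<in> A" "(r, c) \<in> A"
        using inN adj by blast+
      moreover from this have "a \<noteq> v" "b \<noteq> v" "c \<noteq> v" "p \<noteq> v" "r \<noteq> v" using irr pr by auto
      ultimately show ?thesis
        using c pr sym
        by (intro K5_minor_of_list[OF A(1), of "{v}" "{a}" "{p, b}" "{r}" "{c}"]) (auto intro: linked_pair[OF A(1)])
    qed
    show ?thesis
      using fin[of x y z] fin[of y x z] fin[of z x y] no2[of x y z] no2[of y x z] no2[of z x y] xyz sym by blast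
  qed
qed

text \<open>Contracting an edge with at most two common neighbours loses at most three edges; if there is no
  such edge, a vertex of degree at most five yields a \<open>K5\<close> minor.\<close>

lemma K5_minor_free_edge_bound:
  assumes "finite V" "V \<noteq> {}" "A \<subseteq> V \<times> V" "sym A" "irrefl A" "\<not> K5_minor A"
  shows "card A + 6 \<le> 6 * card V"
  using assms
proof (induction "card V + card A" arbitrary: V A rule: less_induct)
  case less
  note V = less.prems(1,2) and A = less.prems(3-6)
  have fA: "finite A" using V(1) A(1) by (meson finite_SigmaI finite_subset)
  have sym: "(b, a) \<in> A" if "(a, b) \<in> A" for a b
    using that A(2) by (rule symD[rotated])
  have irr: "(a, a) \<notin> A" for a
    using A(3) by (simp add: irrefl_def)
  have cV: "card V > 0" using V by (simp add: card_gt_0_iff)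
  show ?case
  proof (cases "card V = 1")
    case True
    then obtain x where "V = {x}" by (auto simp: card_1_singleton_iff)
    then have "A = {}" using A(1) irr by auto
    then show ?thesis using True by simp
  next
    case False
    then have V2: "card V \<ge> 2" using cV by simp
    have Vv: "card (V - {v}) = card V - 1" "V - {v} \<noteq> {}" "card (V - {v}) < card V" if "v \<in> V" for v
    proof -
      show c: "card (V - {v}) = card V - 1" using that V(1) by simp
      then show "card (V - {v}) < card V" using V2 by simp
      have "card (V - {v}) \<noteq> 0" using c V2 by simp
      then show "V - {v} \<noteq> {}" by (metis card.empty)
    qed
    consider v where "v \<in> V" "A `` {v} = {}"
      | u v where "(u, v) \<in> A" "card (A `` {u} \<inter> A `` {v}) \<le> 2"
      | "\<forall>v\<in>V. A `` {v} \<noteq> {}" "\<forall>u v. (u, v) \<in> A \<longrightarrow> card (A `` {u} \<inter> A `` {v}) \<ge> 3"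
      by fastforce
    then show ?thesis
    proof cases
      case (1 v)
      then have "A \<subseteq> (V - {v}) \<times> (V - {v})" using A(1) sym by blast
      then have "card A + 6 \<le> 6 * card (V - {v})"
        using less.hyps[of "V - {v}" A] Vv[OF 1(1)] V(1) A by simp
      then show ?thesis using Vv[OF 1(1)] by simp
    next
      case (2 u v)
      let ?C = "contract A u v"
      have uv: "u \<in> V" "v \<in> V" "u \<noteq> v" using 2 A(1) irr by auto
      have sub: "?C \<subseteq> (V - {v}) \<times> (V - {v})"
        using A(1) uv unfolding contract_def by (auto split: if_splits)
      have "sym ?C" by (rule sym_contract[OF A(2)])
      moreover have "irrefl ?C" by (rule irrefl_contract)
      moreover have "\<not> K5_minor ?C" using K5_minor_contract[OF A(2) 2(1)] A(4) by blast
      moreover have "card ?C \<le> card A"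
        unfolding contract_def by (meson Diff_subset card_image_le card_mono fA finite_imageI order_trans)
      ultimately have "card ?C + 6 \<le> 6 * card (V - {v})"
        using less.hyps[of "V - {v}" ?C] Vv[OF uv(2)] V(1) sub by simp
      then show ?thesis
        using card_contract[OF fA A(2,3) 2(1)] 2(2) Vv[OF uv(2)] V2 by linarith
    next
      case 3
      obtain v where "v \<in> V" using V by blast
      then obtain u where uv: "(v, u) \<in> A" using 3 by blast
      \<comment> \<open>With no edge to contract, one edge is deleted instead; this is why the
        induction measure includes \<open>card A\<close>. The induction hypothesis still leaves
        \<open>card A < 6 * card V\<close>, enough for a vertex of degree at most five.\<close>
      let ?A = "A - {(v, u), (u, v)}"
      have cA: "card ?A = card A - 2" "card A \<ge> 2"
      proof -
        have s: "{(v, u), (u, v)} \<subseteq> A" "v \<noteq> u" using uv sym irr by auto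
        then have "card {(v, u), (u, v)} = 2" by auto
        then show "card ?A = card A - 2" "card A \<ge> 2"
          using s(1) fA card_mono[OF fA s(1)] by (simp_all add: card_Diff_subset)
      qed
      have "sym ?A" using sym by (auto intro!: symI)
      moreover have "irrefl ?A" using irr by (auto simp: irrefl_def)
      moreover have "\<not> K5_minor ?A" using K5_minor_mono[of ?A A] A(4) by blast
      ultimately have "card ?A + 6 \<le> 6 * card V"
        using less.hyps[of V ?A] V cA A(1) by auto
      then have "card A < 6 * card V" using cA by linarith
      moreover have "6 * card V \<le> card A" if "\<forall>v\<in>V. card (A `` {v}) \<ge> 6"
        using sum_mono[of V "\<lambda>_. 6" "\<lambda>v. card (A `` {v})"] that card_as_degree_sum[OF V(1) V(1) A(1)] by simp
      ultimately obtain w where w: "w \<in> V" "card (A `` {w}) \<le> 5" by fastforce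
      have "K5_minor A"
        using 3 w fA by (intro K5_minor_of_nbhd[OF A(2,3), of w]) (auto simp: finite_Image)
      then show ?thesis using A(4) by blast
    qed
  qed
qed

text \<open>If some \<open>y\<close> has a neighbour \<open>a\<close> with at most one neighbour inside the neighbourhood of \<open>y\<close>,
  contracting \<open>y\<close> into \<open>a\<close> does not decrease the degree sum. Otherwise the neighbours of \<open>Y\<close> span at
  least as many edges as there are vertices among them, and the edge bound, applied to \<open>X \<union> Y\<close> and to \<open>Y\<close> with its
  neighbours, suffices.\<close>

lemma degree_sum_less:
  assumes "finite X" "X \<noteq> {}" "finite Y" "X \<inter> Y = {}" "A \<subseteq> (X \<union> Y) \<times> (X \<union> Y)" "A \<inter> Y \<times> Y = {}"
    "sym A" "irrefl A" "\<not> K5_minor A" "\<And>y. y \<in> Y \<Longrightarrow> 4 \<le> card (A `` {y})"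
  shows "card (A \<inter> X \<times> UNIV) < 10 * card X"
  using assms
proof (induction "card Y" arbitrary: Y A rule: less_induct)
  case less
  note X = less.prems(1,2) and Y = less.prems(3,4) and A = less.prems(5-9) and deg = less.prems(10)
  have fA: "finite A" using X(1) Y(1) A(1) by (meson finite_SigmaI finite_UnI finite_subset)
  have sym: "(b, a) \<in> A" if "(a, b) \<in> A" for a b
    using that A(3) by (rule symD[rotated])
  have irr: "(a, a) \<notin> A" for a
    using A(4) by (simp add: irrefl_def)
  have YX: "b \<in> X" if "(y, b) \<in> A" "y \<in> Y" for y b
    using that A(1,2) by blast
  show ?case
  proof (cases "\<exists>y\<in>Y. \<exists>a\<in>A `` {y}. card (A `` {y} \<inter> A `` {a}) \<le> 1")
    case True
    then obtain y a where y: "y \<in> Y" "(y, a) \<in> A" "card (A `` {y} \<inter> A `` {a}) \<le> 1" by blast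
    let ?C = "contract A a y"
    define f where "f = id(y := a)"
    have f_y: "f y = a" and f_o: "c \<noteq> y \<Longrightarrow> f c = c" for c
      by (simp_all add: f_def)
    have C_iff: "(p, q) \<in> ?C \<longleftrightarrow> p \<noteq> q \<and> (\<exists>c d. (c, d) \<in> A \<and> p = f c \<and> q = f d)" for p q
      unfolding contract_iff f_def ..
    have aX: "a \<in> X" "a \<noteq> y" using y YX Y(2) by blast+
    have ay: "(a, y) \<in> A" using y sym by blast
    have Ci: "\<exists>c d. (c, d) \<in> A \<and> p = f c \<and> q = f d" if "(p, q) \<in> ?C" for p q
      using that C_iff by blast
    have fC: "(f c, f d) \<in> ?C" if "(c, d) \<in> A" "f c \<noteq> f d" for c d
      using that C_iff by blast
    have fXY: "f c \<in> X \<union> (Y - {y})" if "c \<in> X \<union> Y" for c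
      using that aX f_y f_o[of c] by (cases "c = y") auto
    have f_Y: "c \<in> Y" if "f c \<in> Y" for c
      using that y(1) f_o[of c] by (cases "c = y") auto
    have sub: "?C \<subseteq> (X \<union> (Y - {y})) \<times> (X \<union> (Y - {y}))"
    proof (rule subrelI)
      fix p q assume "(p, q) \<in> ?C"
      then obtain c d where cd: "(c, d) \<in> A" "p = f c" "q = f d" using Ci by blast
      then have "c \<in> X \<union> Y" "d \<in> X \<union> Y" using A(1) by blast+
      then show "(p, q) \<in> (X \<union> (Y - {y})) \<times> (X \<union> (Y - {y}))"
        using fXY[of c] fXY[of d] unfolding cd(2,3) by (intro SigmaI)
    qed
    have YY: "?C \<inter> (Y - {y}) \<times> (Y - {y}) = {}"
    proof (rule ccontr)
      assume "?C \<inter> (Y - {y}) \<times> (Y - {y}) \<noteq> {}"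
      then obtain p q where pq: "(p, q) \<in> ?C" "p \<in> Y" "q \<in> Y" by blast
      then obtain c d where cd: "(c, d) \<in> A" "p = f c" "q = f d" using Ci by blast
      then have "c \<in> Y" "d \<in> Y" using f_Y[of c] f_Y[of d] pq(2,3) by simp_all
      then show False using A(2) cd(1) by blast
    qed
    \<comment> \<open>The other vertices of \<open>Y\<close> have all their neighbours in
      \<open>X\<close>, so the contraction moves neither end of these arcs and the degree condition
      persists.\<close>
    have deg': "A `` {z} \<subseteq> ?C `` {z}" if "z \<in> Y - {y}" for z
    proof
      fix d assume "d \<in> A `` {z}"
      then have zd: "(z, d) \<in> A" "d \<in> X" using YX that by auto
      then have "f z = z" "f d = d" "z \<noteq> d" using that Y(2) y(1) irr by (auto intro!: f_o)
      then show "d \<in> ?C `` {z}"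
        using fC[OF zd(1)] by simp
    qed
    have fC': "finite ?C"
      using sub X(1) Y(1) by (meson finite_Diff finite_SigmaI finite_UnI finite_subset)
    have IH: "card (?C \<inter> X \<times> UNIV) < 10 * card X"
    proof (rule less.hyps)
      show "card (Y - {y}) < card Y" by (rule card_Diff1_less[OF Y(1) y(1)])
      show "\<not> K5_minor ?C" using K5_minor_contract[OF A(3) ay] A(5) by blast
      show "4 \<le> card (?C `` {z})" if "z \<in> Y - {y}" for z
        using deg[of z] card_mono[OF _ deg'[OF that]] that fC' by (simp add: finite_Image order_trans)
      show "sym ?C" by (rule sym_contract[OF A(3)])
      show "irrefl ?C" by (rule irrefl_contract)
    qed (use X Y sub YY in auto)
    \<comment> \<open>\<open>M\<close> consists of the new neighbours that \<open>a\<close> gains.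
      If \<open>y\<close> has degree d, the sum over \<open>X\<close> loses d and gains 2
      \<open>card M\<close>, where \<open>card M\<close> is at least d - 2: only \<open>a\<close>
      and at most one common neighbour are missing. Since d is at least 4, the gain is at least the
      loss.\<close>
    define M where "M = A `` {y} - {a} - A `` {a}"
    define A1 where "A1 = A \<inter> X \<times> (- {y})"
    have fy: "finite (A `` {y})" using fA by (rule finite_Image)
    have "card (A `` {y}) \<le> card (M \<union> {a} \<union> (A `` {y} \<inter> A `` {a}))"
      unfolding M_def by (intro card_mono) (use fy in auto)
    also have "\<dots> \<le> card M + card {a} + card (A `` {y} \<inter> A `` {a})"
      by (meson add_le_mono1 card_Un_le order_trans)
    finally have dM: "card (A `` {y}) \<le> card M + 2" using y(3) by simp
    have fM: "finite M" "M \<subseteq> X" "a \<notin> M" "y \<notin> M"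
      using fy YX y(1) irr unfolding M_def by auto
    have "A \<inter> X \<times> UNIV = A1 \<union> A `` {y} \<times> {y}"
      unfolding A1_def using YX y(1) sym by auto
    moreover have "A1 \<inter> A `` {y} \<times> {y} = {}" unfolding A1_def by auto
    moreover have fA1: "finite A1" unfolding A1_def using fA by blast
    ultimately have "card (A \<inter> X \<times> UNIV) = card A1 + card (A `` {y} \<times> {y})"
      using fy by (simp add: card_Un_disjoint)
    then have c1: "card (A \<inter> X \<times> UNIV) = card A1 + card (A `` {y})"
      by (simp add: card_cartesian_product)
    have inC: "A1 \<union> ({a} \<times> M \<union> M \<times> {a}) \<subseteq> ?C \<inter> X \<times> UNIV"
    proof -
      have "(p, q) \<in> ?C" if pq: "(p, q) \<in> A1" for p q
      proof -
        have "(p, q) \<in> A" "f p = p" "f q = q" "p \<noteq> q"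
          using pq irr Y(2) y(1) unfolding A1_def by (auto intro!: f_o)
        then show ?thesis using fC[of p q] by simp
      qed
      moreover have "(a, m) \<in> ?C \<and> (m, a) \<in> ?C" if m: "m \<in> M" for m
      proof -
        have "(y, m) \<in> A" "(m, y) \<in> A" "f m = m" "m \<noteq> a"
          using m fM(3,4) sym unfolding M_def by (auto intro!: f_o)
        then show ?thesis using fC[of y m] fC[of m y] f_y by simp
      qed
      moreover have "A1 \<subseteq> X \<times> UNIV" unfolding A1_def by blast
      ultimately show ?thesis using aX(1) fM(2) by blast
    qed
    have "A1 \<inter> ({a} \<times> M \<union> M \<times> {a}) = {}"
      unfolding A1_def M_def using sym by blast
    then have "card (A1 \<union> ({a} \<times> M \<union> M \<times> {a})) = card A1 + card ({a} \<times> M \<union> M \<times> {a})"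
      using fA1 fM by (intro card_Un_disjoint) auto
    also have "card ({a} \<times> M \<union> M \<times> {a}) = card ({a} \<times> M) + card (M \<times> {a})"
      using fM by (intro card_Un_disjoint) auto
    finally have "card A1 + 2 * card M \<le> card (?C \<inter> X \<times> UNIV)"
      using card_mono[OF _ inC] fC' by (simp add: card_cartesian_product)
    then show ?thesis
      using IH c1 dM deg[OF y(1)] by linarith
  next
    case False
    have two: "2 \<le> card (A `` {y} \<inter> A `` {a})" if "y \<in> Y" "(y, a) \<in> A" for y a
    proof (rule ccontr)
      assume "\<not> ?thesis"
      then have "card (A `` {y} \<inter> A `` {a}) \<le> 1" by linarith
      then show False using False that by blast
    qed
    show ?thesis
    proof (cases "Y = {}")
      case True
      then have "A \<subseteq> X \<times> X" using A(1) by simp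
      moreover from this have "A \<inter> X \<times> UNIV = A" by blast
      ultimately show ?thesis
        using K5_minor_free_edge_bound[OF X _ A(3-5)] by simp
    next
      case False
      define Z where "Z = (\<Union>y\<in>Y. A `` {y})"
      have Z: "Z \<subseteq> X" "finite Z" using YX X(1) unfolding Z_def by (auto intro: finite_subset)
      then have cZ: "card Z \<le> card X" using X(1) by (simp add: card_mono)
      define exy where "exy = card (A \<inter> X \<times> Y)"
      have fin: "finite (A \<inter> S)" for S using fA by blast
      have conv: "card (A \<inter> Y \<times> X) = exy"
      proof -
        have "A \<inter> Y \<times> X = (A \<inter> X \<times> Y)\<inverse>" using sym by auto
        then show ?thesis unfolding exy_def by simp
      qed
      have split: "card (A \<inter> (W \<union> Y) \<times> (W \<union> Y)) = card (A \<inter> W \<times> W) + 2 * exy" if W: "Z \<subseteq> W" "W \<subseteq> X" for W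
      proof -
        have "A \<inter> X \<times> Y \<subseteq> W \<times> Y" "A \<inter> Y \<times> X \<subseteq> Y \<times> W"
          using W sym unfolding Z_def by blast+
        then have "A \<inter> (W \<union> Y) \<times> (W \<union> Y) = A \<inter> W \<times> W \<union> (A \<inter> X \<times> Y \<union> A \<inter> Y \<times> X)"
        proof (intro set_eqI)
          fix e show "e \<in> A \<inter> (W \<union> Y) \<times> (W \<union> Y) \<longleftrightarrow> e \<in> A \<inter> W \<times> W \<union> (A \<inter> X \<times> Y \<union> A \<inter> Y \<times> X)"
          proof (cases e)
            case (Pair p q)
            have "p \<in> W" if "e \<in> A" "p \<in> X" "q \<in> Y"
              using \<open>A \<inter> X \<times> Y \<subseteq> W \<times> Y\<close> that Pair by blast
            moreover have "q \<in> W" if "e \<in> A" "p \<in> Y" "q \<in> X"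
              using \<open>A \<inter> Y \<times> X \<subseteq> Y \<times> W\<close> that Pair by blast
            moreover have "\<not> (e \<in> A \<and> p \<in> Y \<and> q \<in> Y)"
              using A(2) Pair by blast
            moreover have "p \<in> W \<Longrightarrow> p \<in> X" "q \<in> W \<Longrightarrow> q \<in> X"
              using W(2) by blast+
            ultimately show ?thesis
              unfolding Pair Un_iff Int_iff mem_Sigma_iff by argo
          qed
        qed
        moreover have "A \<inter> W \<times> W \<inter> (A \<inter> X \<times> Y \<union> A \<inter> Y \<times> X) = {}"
          "A \<inter> X \<times> Y \<inter> (A \<inter> Y \<times> X) = {}"
          using W Y(2) by blast+
        ultimately show ?thesis
          using fin conv by (simp add: card_Un_disjoint exy_def[symmetric])
      qed
      have AX: "A \<inter> (X \<union> Y) \<times> (X \<union> Y) = A" using A(1) by blast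
      have "card A + 6 \<le> 6 * card (X \<union> Y)"
        using X Y A by (intro K5_minor_free_edge_bound) auto
      then have b1: "card (A \<inter> X \<times> X) + 2 * exy + 6 \<le> 6 * card X + 6 * card Y"
        using split[OF Z(1)] AX X(1) Y by (simp add: card_Un_disjoint)
      have "card (A \<inter> (Z \<union> Y) \<times> (Z \<union> Y)) + 6 \<le> 6 * card (Z \<union> Y)"
      proof (rule K5_minor_free_edge_bound)
        show "sym (A \<inter> (Z \<union> Y) \<times> (Z \<union> Y))" using sym by (auto intro!: symI)
        show "irrefl (A \<inter> (Z \<union> Y) \<times> (Z \<union> Y))" using irr by (auto simp: irrefl_def)
        show "\<not> K5_minor (A \<inter> (Z \<union> Y) \<times> (Z \<union> Y))"
          using A(5) K5_minor_mono[of "A \<inter> (Z \<union> Y) \<times> (Z \<union> Y)" A] by blast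
      qed (use Z Y False in auto)
      moreover have "Z \<inter> Y = {}" using Z(1) Y(2) by blast
      ultimately have b2: "card (A \<inter> Z \<times> Z) + 2 * exy + 6 \<le> 6 * card Z + 6 * card Y"
        using split[OF order_refl Z(1)] Z Y(1) by (simp add: card_Un_disjoint)
      have "2 \<le> card ((A \<inter> Z \<times> Z) `` {a})" if aZ: "a \<in> Z" for a
      proof -
        obtain y where y: "y \<in> Y" "(y, a) \<in> A" using aZ unfolding Z_def by blast
        have "A `` {y} \<inter> A `` {a} \<subseteq> (A \<inter> Z \<times> Z) `` {a}"
          using y aZ unfolding Z_def by blast
        then have "card (A `` {y} \<inter> A `` {a}) \<le> card ((A \<inter> Z \<times> Z) `` {a})"
          by (intro card_mono finite_Image fin)
        then show ?thesis using two[OF y] by linarith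
      qed
      then have b3: "2 * card Z \<le> card (A \<inter> Z \<times> Z)"
        using card_as_degree_sum[OF Z(2) Z(2), of "A \<inter> Z \<times> Z"]
          sum_mono[of Z "\<lambda>_. 2" "\<lambda>a. card ((A \<inter> Z \<times> Z) `` {a})"] by simp
      have "4 \<le> card ((A \<inter> Y \<times> X) `` {y})" if "y \<in> Y" for y
      proof -
        have "(A \<inter> Y \<times> X) `` {y} = A `` {y}" using that YX by blast
        then show ?thesis using deg[OF that] by simp
      qed
      then have b4: "4 * card Y \<le> exy"
        using card_as_degree_sum[OF Y(1) X(1), of "A \<inter> Y \<times> X"] conv
          sum_mono[of Y "\<lambda>_. 4" "\<lambda>a. card ((A \<inter> Y \<times> X) `` {a})"] by simp
      have "A \<inter> X \<times> UNIV = A \<inter> X \<times> X \<union> A \<inter> X \<times> Y" using A(1) by blast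
      moreover have "A \<inter> X \<times> X \<inter> (A \<inter> X \<times> Y) = {}" using Y(2) by blast
      ultimately have "card (A \<inter> X \<times> UNIV) = card (A \<inter> X \<times> X) + exy"
        using fin by (simp add: card_Un_disjoint exy_def[symmetric])
      \<comment> \<open>\<open>b2\<close> and \<open>b3\<close> give 2 \<open>exy\<close> + 6 \<le>
        4 |Z| + 6 |Y|, and by \<open>b4\<close> the last term is at most 3/2 \<open>exy\<close>;
        hence \<open>exy\<close> \<le> 8 |Z| - 12. By \<open>b1\<close> and \<open>b4\<close> the
        degree sum is at most 6 |X| + \<open>exy\<close>/2 - 6, so at most 6 |X| + 4 |Z| -
        12.\<close>
      then show ?thesis using b1 b2 b3 b4 cZ by linarith
    qed
  qed
qed

lemma small_degree_exists:
  assumes "finite X" "X \<noteq> {}" "finite Y" "X \<inter> Y = {}" "A \<subseteq> (X \<union> Y) \<times> (X \<union> Y)" "A \<inter> Y \<times> Y = {}"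
    "sym A" "irrefl A" "\<not> K5_minor A" "\<And>y. y \<in> Y \<Longrightarrow> 4 \<le> card (A `` {y})"
  shows "\<exists>x\<in>X. card (A `` {x}) \<le> 9"
proof (rule ccontr)
  assume none: "\<not> ?thesis"
  then have big: "\<not> card (A `` {x}) \<le> 9" if "x \<in> X" for x
    using that by blast
  have "10 \<le> card ((A \<inter> X \<times> UNIV) `` {x})" if "x \<in> X" for x
  proof -
    have "(A \<inter> X \<times> UNIV) `` {x} = A `` {x}" using that by blast
    then show ?thesis using big[OF that] by simp
  qed
  then have "(\<Sum>x\<in>X. 10) \<le> (\<Sum>x\<in>X. card ((A \<inter> X \<times> UNIV) `` {x}))"
    by (rule sum_mono)
  also have "\<dots> = card (A \<inter> X \<times> UNIV)"
    using assms(1,3,5) by (intro card_as_degree_sum[of X "X \<union> Y", symmetric]) auto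
  finally show False using degree_sum_less[OF assms] by simp
qed

definition stars_to_cliques :: "('a \<times> 'a) set \<Rightarrow> 'a set \<Rightarrow> ('a \<times> 'a) set" where
  "stars_to_cliques A Z =
     {(a, b) \<in> A. a \<notin> Z \<and> b \<notin> Z} \<union> {(a, b). a \<noteq> b \<and> (\<exists>y\<in>Z. (y, a) \<in> A \<and> (y, b) \<in> A)}"

lemma sym_stars_to_cliques: "sym A \<Longrightarrow> sym (stars_to_cliques A Z)"
  unfolding stars_to_cliques_def sym_def by blast

lemma irrefl_stars_to_cliques: "irrefl A \<Longrightarrow> irrefl (stars_to_cliques A Z)"
  unfolding stars_to_cliques_def irrefl_def by blast

text \<open>The simultaneous replacement agrees with one star at a time: the centres are pairwise
  nonadjacent, so earlier replacements leave the neighbourhood of the next centre unchanged.\<close>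

lemma stars_to_cliques_minors:
  assumes "finite Z" "sym A" "irrefl A" "A \<inter> Z \<times> Z = {}"
    and "\<And>y. y \<in> Z \<Longrightarrow> finite (A `` {y}) \<and> card (A `` {y}) \<le> 3"
    and "\<not> K5_minor A" "\<not> K33_minor A"
  shows "\<not> K5_minor (stars_to_cliques A Z) \<and> \<not> K33_minor (stars_to_cliques A Z)"
  using assms(1,4,5)
proof (induction Z rule: finite_induct)
  case empty
  have "stars_to_cliques A {} = A" by (auto simp: stars_to_cliques_def)
  then show ?case using assms(6,7) by simp
next
  case (insert y Z)
  let ?A = "stars_to_cliques A Z"
  have indep: "(a, b) \<notin> A" if "a \<in> insert y Z" "b \<in> insert y Z" for a b
    using insert.prems(1) that by blast
  have ys: "(y, b) \<in> ?A \<longleftrightarrow> (y, b) \<in> A" for b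
    using indep[of y b] indep[of _ y] insert.hyps(2) unfolding stars_to_cliques_def by blast
  have nbrs: "?A `` {y} = A `` {y}"
    using ys by blast
  have "(a, b) \<in> stars_to_cliques A (insert y Z) \<longleftrightarrow> (a, b) \<in> star_to_clique ?A y" for a b
    using indep[of _ a] indep[of _ b] ys unfolding star_to_clique_def stars_to_cliques_def by blast
  then have eq: "stars_to_cliques A (insert y Z) = star_to_clique ?A y"
    by auto
  have "\<not> K5_minor ?A \<and> \<not> K33_minor ?A"
    using insert.prems by (intro insert.IH) auto
  moreover have "(y, y) \<notin> ?A" using ys indep by blast
  moreover have "finite (?A `` {y})" "card (?A `` {y}) \<le> 3"
    using insert.prems(2)[of y] nbrs by auto
  ultimately show ?case
    unfolding eq using star_to_clique_K5_minor star_to_clique_K33_minor sym_stars_to_cliques[OF assms(2)] by metis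
qed

section \<open>Domination and packing\<close>

lemma dominated_second_nbhd:
  assumes "finite V" "A \<subseteq> V \<times> V" "sym A" "irrefl A" "\<not> K5_minor A" "\<not> K33_minor A"
    and X: "X \<subseteq> V" "X \<noteq> {}"
  obtains v D where "v \<in> X" "D \<subseteq> V" "card D \<le> 10" "v \<in> D"
    "\<And>w. w \<in> X \<Longrightarrow> insert v (A `` {v}) \<inter> insert w (A `` {w}) \<noteq> {} \<Longrightarrow> \<exists>d\<in>D. w \<in> insert d (A `` {d})"
proof -
  have sym: "(b, a) \<in> A" if "(a, b) \<in> A" for a b
    using that assms(3) by (rule symD[rotated])
  have irr: "(a, a) \<notin> A" for a
    using assms(4) by (simp add: irrefl_def)
  have fA: "finite A" using assms(1,2) by (meson finite_SigmaI finite_subset)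
  define Y where "Y = V - X"
  \<comment> \<open>A path of length two between vertices of \<open>X\<close> uses no arc inside
    \<open>Y\<close>, so none is lost.\<close>
  define A1 where "A1 = A - Y \<times> Y"
  define Z where "Z = {y \<in> Y. card (A1 `` {y}) \<le> 3}"
  define A2 where "A2 = stars_to_cliques A1 Z"
  have fA1: "finite A1" unfolding A1_def using fA by blast
  have A1: "sym A1" "irrefl A1" "A1 \<inter> Y \<times> Y = {}" "A1 \<subseteq> A"
    using sym irr unfolding A1_def irrefl_def by (auto intro!: symI)
  have "\<not> K5_minor A1" "\<not> K33_minor A1"
    using assms(5,6) K5_minor_mono[OF A1(4)] minor_model_mono[OF A1(4)] unfolding K33_minor_def by blast+
  moreover have "finite Z" "Z \<subseteq> Y" unfolding Z_def Y_def using assms(1) by auto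
  moreover have "A1 \<inter> Z \<times> Z = {}" using A1(3) \<open>Z \<subseteq> Y\<close> by blast
  moreover have "finite (A1 `` {y}) \<and> card (A1 `` {y}) \<le> 3" if "y \<in> Z" for y
    using that fA1 unfolding Z_def by (simp add: finite_Image)
  ultimately have A2: "\<not> K5_minor A2"
    using stars_to_cliques_minors[of Z A1] A1 unfolding A2_def by blast
  have Ynb: "b \<in> X" if "(y, b) \<in> A1" "y \<in> Y" for y b
    using that assms(2) unfolding A1_def Y_def by blast
  have XA1: "(x, b) \<in> A1" if "(x, b) \<in> A" "x \<in> X" for x b
    using that unfolding A1_def Y_def by blast
  have A2_sub: "A2 \<subseteq> (X \<union> (Y - Z)) \<times> (X \<union> (Y - Z))"
  proof (rule subrelI)
    fix a b assume "(a, b) \<in> A2"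
    then consider "(a, b) \<in> A1" "a \<notin> Z" "b \<notin> Z" | y where "y \<in> Z" "(y, a) \<in> A1" "(y, b) \<in> A1"
      unfolding A2_def stars_to_cliques_def by blast
    then show "(a, b) \<in> (X \<union> (Y - Z)) \<times> (X \<union> (Y - Z))"
    proof cases
      case 1
      then show ?thesis using assms(2) A1(4) unfolding Y_def by blast
    next
      case 2
      then show ?thesis using Ynb \<open>Z \<subseteq> Y\<close> by blast
    qed
  qed
  have A2_YY: "A2 \<inter> (Y - Z) \<times> (Y - Z) = {}"
  proof -
    have "(a, b) \<notin> A2" if "a \<in> Y - Z" "b \<in> Y - Z" for a b
    proof
      assume "(a, b) \<in> A2"
      then have "(a, b) \<in> A1 \<or> (\<exists>y\<in>Z. (y, a) \<in> A1)"
        unfolding A2_def stars_to_cliques_def by blast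
      then show False using A1(3) that Ynb \<open>Z \<subseteq> Y\<close> unfolding Y_def by blast
    qed
    then show ?thesis by blast
  qed
  have "4 \<le> card (A2 `` {y})" if y: "y \<in> Y - Z" for y
  proof -
    have "A1 `` {y} \<subseteq> A2 `` {y}"
    proof
      fix b assume "b \<in> A1 `` {y}"
      then have "(y, b) \<in> A1" "b \<notin> Z" using Ynb[of y b] y \<open>Z \<subseteq> Y\<close> unfolding Y_def by blast+
      then show "b \<in> A2 `` {y}" using y unfolding A2_def stars_to_cliques_def by blast
    qed
    moreover have "finite A2"
      using A2_sub assms(1) X(1) unfolding Y_def by (meson finite_Diff finite_SigmaI finite_UnI finite_subset)
    ultimately have "card (A1 `` {y}) \<le> card (A2 `` {y})"
      by (intro card_mono finite_Image)
    then show ?thesis using y unfolding Z_def by auto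
  qed
  then have "\<exists>x\<in>X. card (A2 `` {x}) \<le> 9"
    using assms(1) X A2 A2_sub A2_YY sym_stars_to_cliques[OF A1(1), of Z] irrefl_stars_to_cliques[OF A1(2), of Z]
    by (intro small_degree_exists[of X "Y - Z"]) (auto simp: Y_def A2_def intro: finite_subset)
  then obtain v where v: "v \<in> X" "card (A2 `` {v}) \<le> 9" by blast
  \<comment> \<open>Behind a clique edge any common neighbour of \<open>v\<close> and
    \<open>w\<close> serves, because the dominating vertices are chosen from all of
    \<open>V\<close>.\<close>
  define g where "g w = (if (v, w) \<in> A1 then w else (SOME y. (y, v) \<in> A1 \<and> (y, w) \<in> A1))" for w
  have fin: "finite (A2 `` {v})"
    using A2_sub assms(1) X(1) unfolding Y_def by (meson finite_Diff finite_Image finite_SigmaI finite_UnI finite_subset)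
  have g: "g w = w \<and> (v, w) \<in> A1 \<or> (g w, v) \<in> A1 \<and> (g w, w) \<in> A1" if "(v, w) \<in> A2" for w
  proof (cases "(v, w) \<in> A1")
    case True
    then show ?thesis by (simp add: g_def)
  next
    case False
    then have "\<exists>y. (y, v) \<in> A1 \<and> (y, w) \<in> A1"
      using that unfolding A2_def stars_to_cliques_def by blast
    then have "(g w, v) \<in> A1 \<and> (g w, w) \<in> A1"
      using False someI_ex[of "\<lambda>y. (y, v) \<in> A1 \<and> (y, w) \<in> A1"] by (simp add: g_def)
    then show ?thesis by blast
  qed
  let ?D = "insert v (g ` (A2 `` {v}))"
  show thesis
  proof
    show "v \<in> X" "v \<in> ?D" using v by auto
    have "g w \<in> V" if "(v, w) \<in> A2" for w
      using g[OF that] A1(4) assms(2) by auto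
    then show "?D \<subseteq> V" using v X by auto
    have "card ?D \<le> Suc (card (g ` (A2 `` {v})))"
      by (simp add: card_insert_le_m1 card_insert_if fin)
    also have "\<dots> \<le> 10"
      using card_image_le[OF fin, of g] v(2) by linarith
    finally show "card ?D \<le> 10" .
    fix w assume w: "w \<in> X" "insert v (A `` {v}) \<inter> insert w (A `` {w}) \<noteq> {}"
    show "\<exists>d\<in>?D. w \<in> insert d (A `` {d})"
    proof (cases "w \<in> insert v (A `` {v})")
      case True
      then show ?thesis by blast
    next
      case False
      then obtain z where z: "(v, z) \<in> A" "z = w \<or> (w, z) \<in> A" using w(2) sym by blast
      then have zw: "(w, z) \<in> A" using False by blast
      have A1z: "(v, z) \<in> A1" "(z, v) \<in> A1" "(z, w) \<in> A1"
        using XA1[OF z(1) v(1)] XA1[OF zw w(1)] A1(1) by (auto dest: symD)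
      have notZ: "v \<notin> Z" "w \<notin> Z" using v(1) w(1) \<open>Z \<subseteq> Y\<close> unfolding Y_def by blast+
      show ?thesis
      \<comment> \<open>Here \<open>z\<close> is the middle of a path from \<open>v\<close> to
        \<open>w\<close>. If it was replaced, \<open>v w\<close> is a clique edge and
        \<open>g w\<close> dominates \<open>w\<close>; otherwise \<open>z\<close> is still a
        neighbour of \<open>v\<close>, is fixed by \<open>g\<close>, and dominates \<open>w\<close>
        itself.\<close>
      proof (cases "z \<in> Z")
        case True
        then have "(v, w) \<in> A2"
          using A1z False unfolding A2_def stars_to_cliques_def by blast
        then have "g w \<in> ?D" "g w = w \<or> (g w, w) \<in> A"
          using g[of w] A1(4) by blast+
        then show ?thesis by (intro bexI[of _ "g w"]) auto
      next
        case False
        then have "(v, z) \<in> A2" "g z = z"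
          using A1z notZ unfolding A2_def stars_to_cliques_def g_def by auto
        then have "z \<in> ?D" by (metis Image_singleton_iff imageI insertCI)
        moreover have "w \<in> insert z (A `` {z})" using zw sym by blast
        ultimately show ?thesis by blast
      qed
    qed
  qed
qed

text \<open>Requiring \<open>P\<close> to lie in \<open>X\<close> lets the induction add
  \<open>v\<close>: all later members are chosen among vertices whose neighbourhoods avoid that of
  \<open>v\<close>.\<close>

lemma domination_le_packing:
  assumes A: "finite V" "A \<subseteq> V \<times> V" "sym A" "irrefl A" "\<not> K5_minor A" "\<not> K33_minor A"
    and X: "X \<subseteq> V"
  shows "\<exists>D P. D \<subseteq> V \<and> P \<subseteq> X \<and> X \<subseteq> (\<Union>d\<in>D. insert d (A `` {d})) \<and> card D \<le> 10 * card P \<and>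
    pairwise (\<lambda>u v. insert u (A `` {u}) \<inter> insert v (A `` {v}) = {}) P"
  using X
proof (induction "card X" arbitrary: X rule: less_induct)
  case less
  show ?case
  proof (cases "X = {}")
    case True
    then show ?thesis by (intro exI[of _ "{}"]) auto
  next
    case False
    let ?N = "\<lambda>u. insert u (A `` {u})"
    obtain v D where v: "v \<in> X" "D \<subseteq> V" "card D \<le> 10" "v \<in> D"
      and D: "\<And>w. w \<in> X \<Longrightarrow> ?N v \<inter> ?N w \<noteq> {} \<Longrightarrow> \<exists>d\<in>D. w \<in> ?N d"
      using dominated_second_nbhd[OF A less.prems False] by metis
    define X' where "X' = {w \<in> X. ?N v \<inter> ?N w = {}}"
    have fX: "finite X" using less.prems A(1) finite_subset by blast
    have X': "X' \<subseteq> X" "v \<notin> X'" unfolding X'_def by auto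
    have "card X' < card X"
      using X' v(1) fX by (intro psubset_card_mono) auto
    moreover have "X' \<subseteq> V"
      using X'(1) less.prems by blast
    ultimately have "\<exists>D P. D \<subseteq> V \<and> P \<subseteq> X' \<and> X' \<subseteq> (\<Union>d\<in>D. ?N d) \<and> card D \<le> 10 * card P \<and>
        pairwise (\<lambda>u v. ?N u \<inter> ?N v = {}) P"
      by (rule less.hyps)
    then obtain D' P where IH: "D' \<subseteq> V" "P \<subseteq> X'" "X' \<subseteq> (\<Union>d\<in>D'. ?N d)" "card D' \<le> 10 * card P"
        "pairwise (\<lambda>u v. ?N u \<inter> ?N v = {}) P"
      by (elim exE conjE) (rule that)
    have PX: "P \<subseteq> X" using IH(2) X'(1) by blast
    have vP: "v \<notin> P" using IH(2) X'(2) by blast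
    have "finite P" using PX fX by (rule finite_subset)
    have disj: "?N v \<inter> ?N w = {}" if "w \<in> P" for w
      using that IH(2) unfolding X'_def by blast
    have "X \<subseteq> (\<Union>d\<in>D \<union> D'. ?N d)"
    proof
      fix w assume "w \<in> X"
      then show "w \<in> (\<Union>d\<in>D \<union> D'. ?N d)"
        using D[of w] IH(3) unfolding X'_def by (cases "?N v \<inter> ?N w = {}") blast+
    qed
    moreover have "card (D \<union> D') \<le> 10 * card (insert v P)"
      using card_Un_le[of D D'] v(3) IH(4) vP \<open>finite P\<close> by simp
    moreover have "pairwise (\<lambda>u v. ?N u \<inter> ?N v = {}) (insert v P)"
      unfolding pairwise_insert using IH(5) disj by blast
    moreover have "D \<union> D' \<subseteq> V" "insert v P \<subseteq> X"
      using v(1,2) IH(1) PX by simp_all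
    ultimately show ?thesis by blast
  qed
qed

section \<open>Plane drawings exclude \<open>K5\<close> and \<open>K33\<close> minors\<close>

text \<open>A model does not say that its branch sets consist of vertices of the graph. For the
  patterns in use this follows, since each member of a branch set carries an arc.\<close>

lemma minor_model_in_Domain:
  assumes m: "minor_model n R A B" and i: "i < n" "j < n" "i \<noteq> j" "R i j" and x: "x \<in> B i"
  shows "\<exists>b. (x, b) \<in> A"
proof (cases "B i = {x}")
  case True
  have "A \<inter> B i \<times> B j \<noteq> {}"
    using m i unfolding minor_model_def by simp
  then show ?thesis using True by auto
next
  case False
  have "linked A (B i)"
    using m i(1) unfolding minor_model_def by simp
  moreover have "{x} \<subseteq> B i" "{x} \<noteq> {}" "{x} \<noteq> B i"
    using x False by auto
  ultimately obtain a b where "(a, b) \<in> A" "a \<in> {x}"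
    by (rule linkedE)
  then show ?thesis by blast
qed

lemma graph_arcs_ends:
  assumes "graph G"
  shows "finite (verts G)" "arcs_ends G \<subseteq> verts G \<times> verts G" "sym (arcs_ends G)" "irrefl (arcs_ends G)"
proof -
  interpret graph G by (rule assms)
  show "finite (verts G)" by simp
  show "arcs_ends G \<subseteq> verts G \<times> verts G" using adj_in_verts by auto
  show "sym (arcs_ends G)" using sym_arcs by (simp add: symmetric_def)
  show "irrefl (arcs_ends G)" using adj_not_same by (auto simp: irrefl_def)
qed

context
  fixes G :: "('a, 'b) pre_digraph" and p :: "'a \<Rightarrow> complex" and c :: "'a set \<Rightarrow> real \<Rightarrow> complex"
  assumes G: "graph G" and drawing: "plane_drawing G p c"
begin

definition blob :: "'a set \<Rightarrow> complex set" where
  "blob B = p ` B \<union> (\<Union>e\<in>{e \<in> edges G. e \<subseteq> B}. path_image (c e))"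

lemma edge_props:
  assumes "e \<in> edges G"
  shows "e \<subseteq> verts G" "arc (c e)" "{pathstart (c e), pathfinish (c e)} = p ` e"
    "path_image (c e) \<inter> p ` verts G = p ` e" "p ` e \<subseteq> path_image (c e)"
proof -
  show "e \<subseteq> verts G" using assms graph_arcs_ends(2)[OF G] by (auto simp: edges_def)
  show "arc (c e)" "{pathstart (c e), pathfinish (c e)} = p ` e" "path_image (c e) \<inter> p ` verts G = p ` e"
    using drawing assms by (auto simp: plane_drawing_def)
  then show "p ` e \<subseteq> path_image (c e)" by blast
qed

lemma edges_inter: "e \<in> edges G \<Longrightarrow> f \<in> edges G \<Longrightarrow> e \<noteq> f \<Longrightarrow> path_image (c e) \<inter> path_image (c f) \<subseteq> p ` (e \<inter> f)"
  using drawing by (auto simp: plane_drawing_def)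

lemma p_inj: "u \<in> verts G \<Longrightarrow> w \<in> verts G \<Longrightarrow> p u = p w \<Longrightarrow> u = w"
  using drawing by (auto simp: plane_drawing_def inj_on_def)

lemma finite_edges: "finite (edges G)"
  using graph_arcs_ends(1)[OF G] edge_props(1) by (meson PowI finite_Pow_iff finite_subset subsetI)

text \<open>An edge not contained in \<open>B\<close> differs from every edge drawn in the blob, so
  the two can share only images of common ends.\<close>

lemma edge_inter_blob:
  assumes e: "e \<in> edges G" "\<not> e \<subseteq> B" and B: "B \<subseteq> verts G"
  shows "path_image (c e) \<inter> blob B = p ` (e \<inter> B)"
proof
  show "p ` (e \<inter> B) \<subseteq> path_image (c e) \<inter> blob B"
    using edge_props(5)[OF e(1)] unfolding blob_def by blast
  have "path_image (c e) \<inter> p ` B \<subseteq> p ` (e \<inter> B)"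
  proof
    fix z assume z: "z \<in> path_image (c e) \<inter> p ` B"
    then obtain b where b: "b \<in> B" "z = p b" by blast
    then have "z \<in> p ` e" using z B edge_props(4)[OF e(1)] by blast
    then obtain a where "a \<in> e" "z = p a" by blast
    then show "z \<in> p ` (e \<inter> B)" using b p_inj[of a b] B edge_props(1)[OF e(1)] by blast
  qed
  moreover have "path_image (c e) \<inter> path_image (c f) \<subseteq> p ` (e \<inter> B)" if "f \<in> edges G" "f \<subseteq> B" for f
    using edges_inter[OF e(1) that(1)] that(2) e(2) by blast
  ultimately show "path_image (c e) \<inter> blob B \<subseteq> p ` (e \<inter> B)"
    unfolding blob_def by blast
qed

lemma blobs_disjoint:
  assumes B: "B \<subseteq> verts G" "B' \<subseteq> verts G" "B \<inter> B' = {}"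
  shows "blob B \<inter> blob B' = {}"
proof -
  have "path_image (c e) \<inter> blob B' = {}" if "e \<in> edges G" "e \<subseteq> B" for e
  proof -
    have "e \<noteq> {}" using that(1) by (auto simp: edges_def)
    then show ?thesis
      using edge_inter_blob[OF that(1) _ B(2)] that(2) B(3) by blast
  qed
  moreover have "path_image (c e) \<inter> p ` B = {}" if "e \<in> edges G" "e \<subseteq> B'" for e
  proof -
    have "e \<noteq> {}" using that(1) by (auto simp: edges_def)
    then have "path_image (c e) \<inter> blob B = {}"
      using edge_inter_blob[OF that(1) _ B(1)] that(2) B(3) by blast
    then show ?thesis unfolding blob_def by blast
  qed
  moreover have "p ` B \<inter> p ` B' = {}"
    using p_inj B by blast
  ultimately show ?thesis
    unfolding blob_def by blast
qed

lemma compact_blob: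
  assumes "B \<subseteq> verts G"
  shows "compact (blob B)"
proof -
  have "finite B" using assms graph_arcs_ends(1)[OF G] finite_subset by blast
  then have "compact (p ` B)" by (simp add: finite_imp_compact)
  moreover have "compact (\<Union>e\<in>{e \<in> edges G. e \<subseteq> B}. path_image (c e))"
    using finite_edges edge_props(2) by (intro compact_UN) (auto intro: compact_path_image arc_imp_path)
  ultimately show ?thesis unfolding blob_def by (rule compact_Un)
qed

lemma path_connected_edge: "e \<in> edges G \<Longrightarrow> path_connected (path_image (c e))"
  using edge_props(2) by (simp add: arc_imp_path path_connected_path_image)

lemma path_connected_blob:
  assumes B: "linked (arcs_ends G) B"
  shows "path_connected (blob B)"
proof -
  have edge: "path_component (blob B) z z'" if "e \<in> edges G" "e \<subseteq> B" "z \<in> path_image (c e)" "z' \<in> path_image (c e)" for e z z'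
  proof -
    have "path_image (c e) \<subseteq> blob B" using that unfolding blob_def by blast
    then show ?thesis
      using path_connected_edge[OF that(1)] that(3,4) path_component_of_subset
      unfolding path_connected_component by blast
  qed
  have verts: "path_component (blob B) (p x) (p y)" if x: "x \<in> B" and y: "y \<in> B" for x y
  proof -
    \<comment> \<open>The vertices reachable from \<open>x\<close> inside the blob cannot form a
      proper cut of \<open>B\<close>, since a crossing edge is itself drawn in the blob.\<close>
    let ?S = "{y \<in> B. path_component (blob B) (p x) (p y)}"
    have "x \<in> ?S" using x by (auto simp: blob_def path_component_refl)
    moreover have "?S = B"
    proof (rule ccontr)
      assume neq: "?S \<noteq> B"
      have sub: "?S \<subseteq> B" "?S \<noteq> {}" using \<open>x \<in> ?S\<close> by blast+
      obtain a b where ab: "(a, b) \<in> arcs_ends G" "a \<in> ?S" "b \<in> B" "b \<notin> ?S"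
        by (rule linkedE[OF B sub neq])
      then have e: "{a, b} \<in> edges G" by (auto simp: edges_def)
      then have "path_component (blob B) (p a) (p b)"
        using edge_props(5)[OF e] ab by (intro edge[OF e]) auto
      then have "path_component (blob B) (p x) (p b)"
        using ab path_component_trans by blast
      then show False using ab by blast
    qed
    ultimately show ?thesis using y by blast
  qed
  have rep: "\<exists>x\<in>B. path_component (blob B) z (p x)" if z: "z \<in> blob B" for z
  proof -
    consider x where "x \<in> B" "z = p x" | e where "e \<in> edges G" "e \<subseteq> B" "z \<in> path_image (c e)"
      using z unfolding blob_def by blast
    then show ?thesis
    proof cases
      case 1
      then show ?thesis using z path_component_refl by blast
    next
      case 2
      then obtain a where a: "a \<in> e" by (auto simp: edges_def)
      then show ?thesis using edge[OF 2] edge_props(5)[OF 2(1)] 2(2) by blast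
    qed
  qed
  show ?thesis
    unfolding path_connected_component
  proof (intro ballI)
    fix z z' assume "z \<in> blob B" "z' \<in> blob B"
    then obtain x x' where "x \<in> B" "path_component (blob B) z (p x)" "x' \<in> B" "path_component (blob B) z' (p x')"
      using rep by meson
    then show "path_component (blob B) z z'"
      using verts[of x x'] by (meson path_component_sym path_component_trans)
  qed
qed

lemma blob_cycle_of_minor:
  assumes m: "minor_model n R (arcs_ends G) B" and n: "n \<ge> 3"
    and R: "\<And>i. Suc i < n \<Longrightarrow> R i (Suc i)" "R (n - 1) 0"
  shows "\<exists>F. blob_cycle n R (\<lambda>i. blob (B i)) F"
proof -
  have BV: "B i \<subseteq> verts G" if i: "i < n" for i
  proof
    fix x assume x: "x \<in> B i"
    have "\<exists>b. (x, b) \<in> arcs_ends G"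
    proof (cases "Suc i < n")
      case True
      then show ?thesis using minor_model_in_Domain[OF m i True _ R(1)[OF True] x] by simp
    next
      case False
      then have "i = n - 1" using i by simp
      then show ?thesis using minor_model_in_Domain[OF m i, of 0] R(2) x n by auto
    qed
    then show "x \<in> verts G" using graph_arcs_ends(2)[OF G] by blast
  qed
  have disj: "B i \<inter> B j = {}" if "i < n" "j < n" "i \<noteq> j" for i j
    using m that unfolding minor_model_def by simp
  define good where "good i j ab \<longleftrightarrow> ab \<in> arcs_ends G \<inter> B i \<times> B j" for i j ab
  \<comment> \<open>The edges chosen for (i, j) and for (j, i) may differ; \<open>FF\<close>
    compares only edges of different unordered pairs.\<close>
  define E where "E i j = (let ab = (SOME ab. good i j ab) in {fst ab, snd ab})" for i j
  have E: "\<exists>a b. E i j = {a, b} \<and> a \<in> B i \<and> b \<in> B j \<and> E i j \<in> edges G"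
    if "i < n" "j < n" "i \<noteq> j" "R i j" for i j
  proof -
    have "arcs_ends G \<inter> B i \<times> B j \<noteq> {}" using m that unfolding minor_model_def by simp
    then have "\<exists>ab. good i j ab" unfolding good_def by blast
    then have "good i j (SOME ab. good i j ab)" by (rule someI_ex)
    then obtain a b where "(SOME ab. good i j ab) = (a, b)" "(a, b) \<in> arcs_ends G" "a \<in> B i" "b \<in> B j"
      unfolding good_def by auto
    then show ?thesis unfolding E_def by (auto simp: edges_def)
  qed
  have Eint: "path_image (c (E i j)) \<inter> blob (B t) = p ` (E i j \<inter> B t)"
    if h: "i < n" "j < n" "i \<noteq> j" "R i j" "t < n" for i j t
  proof -
    obtain a b where ab: "E i j = {a, b}" "a \<in> B i" "b \<in> B j" "E i j \<in> edges G"
      using E[OF h(1-4)] by blast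
    then have "\<not> E i j \<subseteq> B t" using disj[of i t] disj[of j t] h by auto
    then show ?thesis using edge_inter_blob ab(4) BV[OF h(5)] by blast
  qed
  have "blob_cycle n R (\<lambda>i. blob (B i)) (\<lambda>i j. path_image (c (E i j)))"
  proof
    fix i assume i: "i < n"
    show "compact (blob (B i))" using compact_blob BV[OF i] .
    show "path_connected (blob (B i))"
      using m i unfolding minor_model_def by (intro path_connected_blob) simp
  next
    fix i j assume ij: "i < n" "j < n" "i \<noteq> j"
    show "blob (B i) \<inter> blob (B j) = {}"
      by (intro blobs_disjoint BV disj ij)
    assume Rij: "R i j"
    obtain a b where ab: "E i j = {a, b}" "a \<in> B i" "b \<in> B j" "E i j \<in> edges G"
      using E[OF ij Rij] by blast
    show "compact (path_image (c (E i j)))" "path_connected (path_image (c (E i j)))"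
      using edge_props(2)[OF ab(4)] path_connected_edge[OF ab(4)]
      by (simp_all add: arc_imp_path compact_path_image)
    have "a \<notin> B j" using disj[OF ij] ab by blast
    then have "E i j \<inter> B j = {b}" using ab(3) unfolding ab(1) by auto
    then show "\<exists>v. path_image (c (E i j)) \<inter> blob (B j) = {v}"
      using Eint[OF ij Rij ij(2)] by auto
    show "path_image (c (E i j)) \<inter> blob (B i) \<noteq> {}"
      using Eint[OF ij Rij ij(1)] ab by auto
    fix t assume t: "t < n" "t \<noteq> i" "t \<noteq> j"
    then have "B i \<inter> B t = {}" "B j \<inter> B t = {}" using disj ij by auto
    then have "E i j \<inter> B t = {}" using ab(2,3) unfolding ab(1) by auto
    then show "path_image (c (E i j)) \<inter> blob (B t) = {}"
      using Eint[OF ij Rij t(1)] by simp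
  next
    fix i j k l assume ij: "i < n" "j < n" "i \<noteq> j" "R i j" and kl: "k < n" "l < n" "k \<noteq> l" "R k l"
      and ne: "{i, j} \<noteq> {k, l}"
    obtain a b where ab: "E i j = {a, b}" "a \<in> B i" "b \<in> B j" "E i j \<in> edges G"
      using E[OF ij] by blast
    obtain a' b' where ab': "E k l = {a', b'}" "a' \<in> B k" "b' \<in> B l" "E k l \<in> edges G"
      using E[OF kl] by blast
    have same: "s = t" if "s < n" "t < n" "x \<in> B s" "x \<in> B t" for s t x
      using disj that by blast
    have "E i j \<noteq> E k l"
    proof
      assume "E i j = E k l"
      then have "a = a' \<and> b = b' \<or> a = b' \<and> b = a'"
        unfolding ab(1) ab'(1) doubleton_eq_iff .
      then have "i = k \<and> j = l \<or> i = l \<and> j = k"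
        using same ab ab' ij kl by metis
      then show False using ne by auto
    qed
    then have "path_image (c (E i j)) \<inter> path_image (c (E k l)) \<subseteq> p ` (E i j \<inter> E k l)"
      using edges_inter ab(4) ab'(4) by blast
    moreover have "p ` E i j \<subseteq> blob (B i) \<union> blob (B j)" "p ` E k l \<subseteq> blob (B k) \<union> blob (B l)"
      using ab ab' unfolding blob_def by auto
    ultimately show "path_image (c (E i j)) \<inter> path_image (c (E k l))
        \<subseteq> (blob (B i) \<union> blob (B j)) \<inter> (blob (B k) \<union> blob (B l))"
      by blast
  qed (use n R in auto)
  then show ?thesis by blast
qed

text \<open>The five chords of a pentagon cross along an odd cycle, and the three long diagonals of a hexagon
  cross pairwise; in both cases two sides are not enough.\<close>

lemma plane_drawing_no_K5_minor: "\<not> K5_minor (arcs_ends G)"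
proof
  assume "K5_minor (arcs_ends G)"
  then obtain B where m: "minor_model 5 (\<lambda>_ _. True) (arcs_ends G) B"
    unfolding K5_minor_def by blast
  have "\<exists>F. blob_cycle 5 (\<lambda>_ _. True) (\<lambda>i. blob (B i)) F"
    by (rule blob_cycle_of_minor[OF m]) auto
  then obtain F where F: "blob_cycle 5 (\<lambda>_ _. True) (\<lambda>i. blob (B i)) F" ..
  obtain side :: "nat \<Rightarrow> nat \<Rightarrow> bool" where
    s: "\<forall>i j k l. i < k \<and> k < j \<and> j < l \<and> l < 5 \<and> True \<and> True \<longrightarrow> side i j \<noteq> side k l"
    using blob_cycle.sides_of_chords[OF F] by (rule exE)
  have "side 0 2 \<noteq> side 1 3" "side 1 3 \<noteq> side 2 4" "side 0 3 \<noteq> side 2 4" "side 0 3 \<noteq> side 1 4" "side 0 2 \<noteq> side 1 4"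
    by (rule s[rule_format]; simp)+
  then show False by argo
qed

lemma plane_drawing_no_K33_minor: "\<not> K33_minor (arcs_ends G)"
proof
  let ?R = "\<lambda>i j :: nat. odd (i + j)"
  assume "K33_minor (arcs_ends G)"
  then obtain B where m: "minor_model 6 ?R (arcs_ends G) B"
    unfolding K33_minor_def by blast
  have "\<exists>F. blob_cycle 6 ?R (\<lambda>i. blob (B i)) F"
    by (rule blob_cycle_of_minor[OF m]) auto
  then obtain F where F: "blob_cycle 6 ?R (\<lambda>i. blob (B i)) F" ..
  obtain side :: "nat \<Rightarrow> nat \<Rightarrow> bool" where
    s: "\<forall>i j k l. i < k \<and> k < j \<and> j < l \<and> l < 6 \<and> ?R i j \<and> ?R k l \<longrightarrow> side i j \<noteq> side k l"
    using blob_cycle.sides_of_chords[OF F] by (rule exE)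
  have "side 0 3 \<noteq> side 1 4" "side 1 4 \<noteq> side 2 5" "side 0 3 \<noteq> side 2 5"
    by (rule s[rule_format]; simp)+
  then show False by argo
qed

end

theorem theorem1p10:
  fixes G :: "('a, 'b) pre_digraph"
  assumes "graph G" and "planar G"
  shows "domination_number G \<le> 10 * packing_number G"
proof -
  obtain p c where pc: "plane_drawing G p c" using assms(2) by (auto simp: planar_def)
  note props = graph_arcs_ends[OF assms(1)]
  have nbhd: "closed_nbhd G v = insert v (arcs_ends G `` {v})" for v
    using props(2) by (auto simp: closed_nbhd_def)
  obtain D P where DP: "D \<subseteq> verts G" "P \<subseteq> verts G" "verts G \<subseteq> (\<Union>d\<in>D. closed_nbhd G d)"
    "card D \<le> 10 * card P" "pairwise (\<lambda>u v. closed_nbhd G u \<inter> closed_nbhd G v = {}) P"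
    using domination_le_packing[OF props plane_drawing_no_K5_minor[OF assms(1) pc]
        plane_drawing_no_K33_minor[OF assms(1) pc] order_refl] unfolding nbhd by blast
  have "closed_nbhd G d \<subseteq> verts G" if "d \<in> D" for d
    using that DP(1) by (auto simp: closed_nbhd_def)
  then have "dominating_set G D"
    using DP(1,3) unfolding dominating_set_def by blast
  then have "domination_number G \<le> card D"
    unfolding domination_number_def using graph.finite_dominating_sets[OF assms(1)] by (intro Min_le) auto
  moreover have "packing G P"
    using DP(2,5) by (simp add: packing_def)
  then have "card P \<le> packing_number G"
    unfolding packing_number_def using graph.finite_packings[OF assms(1)] by (intro Max_ge) auto
  ultimately show ?thesis using DP(4) by linarith
qed

end
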